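(* Let $M:(0,\infty)\to(e,\infty)$ be a continuously differentiable decreasing function with $\lim_{t\to0^+}t\log\log M(t)<\infty$ and $\int_0^\infty\log\log M(t)\,dt<\infty$. Let $\Omega$ be a collection of bounded holomorphic functions on the open strip $S_1^\circ=\{z\in\mathbb C:|\Im z|<\rho\}$ such that $\inf_{F\in\Omega}\delta^+_\infty(F)=\inf_{F\in\Omega}\delta^-_\infty(F)=0$. Suppose $H$ is an entire function such that, for some non-negative integer $N$, $$|H(z)|\le(1+|z|)^N M(d(z,\partial S_1)),\quad z\in\mathbb C\setminus S_1,$$ $$|F(z)H(z)|\le(1+|z|)^N M(d(z,\partial S_1)),\quad z\in S_1^\circ,\ \text{for all } F\in\Omega.$$ Then $H$ is a polynomial.
   Context: $\rho>0$ is a fixed real number, $S_1=\{z\in\mathbb C:|\Im z|\le\rho\}$, and $d(z,\partial S_1)$ is the Euclidean distance from $z$ to the boundary of $S_1$. For a function $F$ defined on $\mathbb R$, $\delta_\infty^+(F)=-\limsup_{t\to\infty}e^{-\frac{\pi}{2\rho}t}\log|F(t)|$ and $\delta_\infty^-(F)=-\limsup_{t\to\infty}e^{-\frac{\pi}{2\rho}t}\log|F(-t)|$. *)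

theory Defs
  imports "HOL-Complex_Analysis.Complex_Analysis"
begin

definition strip :: "real \<Rightarrow> complex set" where
  "strip \<rho> = {z. \<bar>Im z\<bar> \<le> \<rho>}"

definition open_strip :: "real \<Rightarrow> complex set" where
  "open_strip \<rho> = {z. \<bar>Im z\<bar> < \<rho>}"

definition log_abs :: "complex \<Rightarrow> ereal" where
  "log_abs w = (if w = 0 then -\<infinity> else ereal (ln (cmod w)))"

definition delta_plus :: "real \<Rightarrow> (complex \<Rightarrow> complex) \<Rightarrow> ereal" where
  "delta_plus \<rho> F =
     - Limsup at_top (\<lambda>t::real. ereal (exp (- (pi / (2 * \<rho>)) * t)) * log_abs (F (complex_of_real t)))"

definition delta_minus :: "real \<Rightarrow> (complex \<Rightarrow> complex) \<Rightarrow> ereal" where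
  "delta_minus \<rho> F =
     - Limsup at_top (\<lambda>t::real. ereal (exp (- (pi / (2 * \<rho>)) * t)) * log_abs (F (complex_of_real (- t))))"

end

theory Submission
  imports Defs
begin

text \<open>
  Write \<open>a = pi / (2 \<rho>)\<close>; in the strip, \<open>exp (a Re z)\<close> is the critical growth of \<open>ln |H|\<close>. If
  \<open>\<delta>\<^sup>+(F) < \<epsilon>\<close> then \<open>-ln |F t| \<le> \<epsilon> exp (a t)\<close> for some arbitrarily large \<open>t\<close>. Dividing the zeros of
  \<open>F\<close> out by Blaschke products and applying Harnack's inequality, the bound on \<open>F H\<close> becomes
  \<open>ln |H z| \<le> 2 \<epsilon> exp (a t) (C / d + ln M(c d))\<close> for \<open>|Re z - t| \<le> 1\<close>, where \<open>d\<close> is the distance to the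
  boundary. Since \<open>ln (C / d + ln M(c d))\<close> is integrable, the \<open>log log\<close> theorem of Levinson and Domar
  removes the dependence on \<open>d\<close>, so that \<open>ln |H| \<le> K \<epsilon> exp (a t)\<close> on the whole crosscut \<open>Re z = t\<close>,
  with \<open>K\<close> independent of \<open>F\<close> and \<open>\<epsilon>\<close>.

  Let \<open>\<phi>(x)\<close> be determined by \<open>ln M(\<phi>(x)) = exp (b x)\<close> with \<open>b < a\<close>. Then \<open>\<phi>\<close> is integrable, because
  \<open>ln ln M\<close> is, hence \<open>{|Im z| < \<rho> + \<phi>(Re z)}\<close> has the same critical growth as the strip, while on its
  boundary \<open>ln |H|\<close> is of order \<open>exp (b Re z)\<close>. The Phragmen--Lindelof principle between the crosscuts,
  for every \<open>\<epsilon>\<close>, gives \<open>ln |H z| \<le> C exp (b |Re z|)\<close>. For small \<open>b\<close> this is below the critical growth of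
  the strip of half-width \<open>\<rho> + 1\<close>, on whose boundary \<open>H\<close> is polynomially bounded.
\<close>

section \<open>Division by a bounded function in the disc\<close>

text \<open>The zero has finite order because \<open>S\<close> is connected and \<open>f\<close>
  does not vanish identically; the local quotient near \<open>a\<close> and
  \<open>f z / (z - a) ^ n\<close> elsewhere agree where both are defined, hence glue.\<close>

lemma holomorphic_factor_out_zero:
  assumes holf: "f holomorphic_on S" and S: "open S" "connected S"
    and a: "a \<in> S" "f a = 0" and nz: "b \<in> S" "f b \<noteq> 0"
  obtains g n where "g holomorphic_on S" "g a \<noteq> 0" "0 < n"
    "\<And>z. z \<in> S \<Longrightarrow> f z = (z - a) ^ n * g z"
proof -
  have nonconst: "\<not> f constant_on S"
    using a nz by (metis constant_on_def)
  obtain g0 r n where r: "0 < n" "0 < r" "ball a r \<subseteq> S" "g0 holomorphic_on ball a r"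
      "\<And>w. w \<in> ball a r \<Longrightarrow> f w = (w - a) ^ n * g0 w"
      "\<And>w. w \<in> ball a r \<Longrightarrow> g0 w \<noteq> 0"
    using holomorphic_factor_zero_nonconstant[OF holf S a nonconst] by metis
  define g where "g z = (if z = a then g0 a else f z / (z - a) ^ n)" for z
  have "g holomorphic_on ball a r"
    by (rule holomorphic_transform[OF r(4)]) (auto simp: g_def r(5))
  moreover have "g holomorphic_on (S - {a})"
  proof (rule holomorphic_transform)
    show "(\<lambda>z. f z / (z - a) ^ n) holomorphic_on (S - {a})"
      by (intro holomorphic_intros holomorphic_on_subset[OF holf]) auto
  qed (auto simp: g_def)
  ultimately have "g holomorphic_on (ball a r \<union> (S - {a}))"
    using S by (intro holomorphic_on_Un) auto
  moreover have "ball a r \<union> (S - {a}) = S"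
    using r a by auto
  ultimately have "g holomorphic_on S" by simp
  moreover have "g a \<noteq> 0" using r by (simp add: g_def)
  moreover have "f z = (z - a) ^ n * g z" if "z \<in> S" for z
    using that r(1) a by (simp add: g_def)
  ultimately show thesis using r(1) that by blast
qed

lemma norm_Cayley_less_one:
  assumes "Re p > 0" "c > 0"
  shows "cmod ((p - of_real c) / (p + of_real c)) < 1"
proof -
  have "(cmod (p - of_real c))\<^sup>2 < (cmod (p + of_real c))\<^sup>2"
    using mult_pos_pos[OF assms] unfolding cmod_power2 by (simp add: power2_eq_square algebra_simps)
  then have "cmod (p - of_real c) < cmod (p + of_real c)"
    by (rule power2_less_imp_less) auto
  then show ?thesis
    by (simp add: norm_divide divide_simps split: if_splits)
qed

text \<open>The Cayley transform turns a function with positive real part into a self-map of the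
  disc, to which the Schwarz lemma applies.\<close>

lemma Harnack_disc:
  assumes holp: "p holomorphic_on ball 0 1" and pos: "\<And>w. cmod w < 1 \<Longrightarrow> Re (p w) > 0"
    and w: "cmod w < 1"
  shows "Re (p w) \<le> Re (p 0) * ((1 + cmod w) / (1 - cmod w))"
proof -
  define c where "c = Re (p 0)"
  have c: "c > 0" using pos[of 0] by (simp add: c_def)
  \<comment> \<open>Removing the imaginary part at 0 makes \<open>P 0\<close> the real number
    \<open>c\<close>, so that \<open>q 0 = 0\<close>.\<close>
  define P where "P z = p z - \<i> * of_real (Im (p 0))" for z
  have P0: "P 0 = of_real c" by (simp add: P_def c_def complex_eq_iff)
  have ReP: "Re (P z) = Re (p z)" for z by (simp add: P_def)
  define q where "q z = (P z - of_real c) / (P z + of_real c)" for z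
  have nz: "P z + of_real c \<noteq> 0" if "cmod z < 1" for z
  proof
    assume "P z + of_real c = 0"
    then have "Re (P z + of_real c) = 0" by simp
    with pos[OF that] c show False by (simp add: ReP)
  qed
  have "q holomorphic_on ball 0 1"
    unfolding q_def P_def using nz by (intro holomorphic_intros holp) (auto simp: P_def)
  moreover have "q 0 = 0" by (simp add: q_def P0)
  moreover have "cmod (q z) < 1" if "cmod z < 1" for z
    unfolding q_def using pos[OF that] c by (intro norm_Cayley_less_one) (auto simp: ReP)
  ultimately have q: "cmod (q w) \<le> cmod w"
    using Schwarz_Lemma(1) w by blast
  have "cmod (P w) - c \<le> cmod (P w - of_real c)"
    using norm_triangle_ineq2[of "P w" "of_real c"] c by simp
  also have "\<dots> = cmod (q w) * cmod (P w + of_real c)"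
    using nz[OF w] by (simp add: q_def norm_divide)
  also have "\<dots> \<le> cmod w * (cmod (P w) + c)"
    using q norm_triangle_ineq[of "P w" "of_real c"] c by (intro mult_mono) auto
  finally have "cmod (P w) * (1 - cmod w) \<le> c * (1 + cmod w)"
    by (simp add: algebra_simps)
  moreover have "Re (p w) \<le> cmod (P w)"
    using complex_Re_le_cmod[of "P w"] by (simp add: ReP)
  ultimately show ?thesis
    using w mult_right_mono[of "Re (p w)" "cmod (P w)" "1 - cmod w"]
    by (simp add: c_def[symmetric] field_simps)
qed

text \<open>Without zeros, \<open>- ln |f|\<close> is a nonnegative harmonic function, the real part
  of \<open>- g\<close> for a holomorphic logarithm \<open>g\<close>. Harnack's inequality controls
  it by its value at 0, and \<open>|h| = |f h| exp (- ln |f|)\<close>.\<close>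

lemma quotient_bound_zero_free:
  assumes R: "R > 1" and hol: "f holomorphic_on ball 0 R" "h holomorphic_on ball 0 R"
    and f1: "\<And>w. cmod w = 1 \<Longrightarrow> cmod (f w) \<le> 1"
    and fh: "\<And>w. cmod w = 1 \<Longrightarrow> cmod (f w * h w) \<le> m"
    and nz: "\<And>w. cmod w < 1 \<Longrightarrow> f w \<noteq> 0" and w: "cmod w < 1"
  shows "cmod (h w) \<le> m * exp (- ln (cmod (f 0)) * ((1 + cmod w) / (1 - cmod w)))"
proof -
  have sub: "cball 0 1 \<subseteq> ball (0::complex) R" using R by auto
  have maxmod: "cmod (k z) \<le> B"
    if "k holomorphic_on ball 0 R" "\<And>w. cmod w = 1 \<Longrightarrow> cmod (k w) \<le> B" "cmod z < 1" for k B z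
  proof (rule maximum_modulus_frontier[of k "ball 0 1"])
    show "k holomorphic_on interior (ball 0 1)"
      using that(1) sub by (meson ball_subset_cball holomorphic_on_subset interior_subset order_trans)
    show "continuous_on (closure (ball 0 1)) k"
      using that(1) sub by (metis closure_ball continuous_on_subset holomorphic_on_imp_continuous_on zero_less_one)
  qed (use that in auto)
  have f_le: "cmod (f z) \<le> 1" if "cmod z < 1" for z
    using maxmod[OF hol(1) f1 that] .
  have fh_le: "cmod (f z * h z) \<le> m" if "cmod z < 1" for z
    using maxmod[of "\<lambda>z. f z * h z"] hol fh that by (auto intro: holomorphic_intros)
  have fb: "f holomorphic_on ball 0 1"
    using hol(1) sub by (meson ball_subset_cball holomorphic_on_subset order_trans)
  obtain g where g: "g holomorphic_on ball 0 1" "\<And>z. z \<in> ball 0 1 \<Longrightarrow> f z = exp (g z)"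
    using contractible_imp_holomorphic_log[OF fb] nz
    by (metis convex_ball convex_imp_contractible mem_ball_0)
  have Reg: "Re (g z) = ln (cmod (f z))" if "cmod z < 1" for z
    using g(2)[of z] that by simp
  have le: "- ln (cmod (f w)) \<le> - ln (cmod (f 0)) * ((1 + cmod w) / (1 - cmod w))"
  proof (rule field_le_epsilon)
    fix e :: real assume e: "e > 0"
    define Q where "Q = (1 + cmod w) / (1 - cmod w)"
    have Q: "Q > 0" using w unfolding Q_def by (intro divide_pos_pos) (auto intro: add_pos_nonneg)
    \<comment> \<open>\<open>Harnack_disc\<close> wants strict positivity, which fails where
      \<open>|f| = 1\<close>; the shift by \<open>e / Q\<close> restores it and costs at most
      \<open>e\<close> after multiplication by \<open>Q\<close>.\<close>
    have "Re (of_real (e / Q) - g w) \<le> Re (of_real (e / Q) - g 0) * ((1 + cmod w) / (1 - cmod w))"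
    proof (rule Harnack_disc[OF _ _ w])
      show "(\<lambda>z. of_real (e / Q) - g z) holomorphic_on ball 0 1"
        by (intro holomorphic_intros g)
      show "0 < Re (of_real (e / Q) - g z)" if "cmod z < 1" for z
        using f_le[OF that] nz[OF that] e Q Reg[OF that] by (simp add: add_pos_nonneg)
           (smt (verit) divide_pos_pos ln_le_zero_iff zero_less_norm_iff)
    qed
    then have "e / Q - Re (g w) \<le> (e / Q - Re (g 0)) * Q"
      by (simp add: Q_def)
    also have "\<dots> = - Re (g 0) * Q + e"
      using Q by (simp add: field_simps)
    finally have "- Re (g w) \<le> - Re (g 0) * Q + e"
      using e Q by (smt (verit) divide_pos_pos)
    then show "- ln (cmod (f w)) \<le> - ln (cmod (f 0)) * ((1 + cmod w) / (1 - cmod w)) + e"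
      using Reg[OF w] Reg[of 0] by (simp add: Q_def)
  qed
  have "cmod (h w) = cmod (f w * h w) * exp (- ln (cmod (f w)))"
    using nz[OF w] by (simp add: norm_mult exp_minus)
  also have "\<dots> \<le> m * exp (- ln (cmod (f 0)) * ((1 + cmod w) / (1 - cmod w)))"
    using fh_le[OF w] le by (intro mult_mono) (auto intro: order_trans[OF norm_ge_zero])
  finally show ?thesis .
qed

text \<open>This is why a Blaschke factor has modulus 1 on the circle: there 1 may be replaced by
  \<open>w * cnj w\<close>.\<close>

lemma norm_Blaschke_numerator:
  assumes "cmod w = 1"
  shows "cmod (1 - cnj a * w) = cmod (w - a)"
proof -
  have "w * cnj w = 1" using assms complex_norm_square[of w] by simp
  then have "1 - cnj a * w = w * cnj (w - a)" by (simp add: algebra_simps)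
  then show ?thesis using assms by (metis complex_mod_cnj mult_1 norm_mult)
qed

text \<open>Zeros of \<open>f\<close> are divided out one at a time by Blaschke factors; this leaves \<open>|f|\<close> unchanged
  on the circle and can only increase \<open>|f 0|\<close>.\<close>

lemma quotient_bound_disc:
  assumes R: "R > 1" and hol: "f holomorphic_on ball 0 R" "h holomorphic_on ball 0 R"
    and f1: "\<And>w. cmod w = 1 \<Longrightarrow> cmod (f w) \<le> 1"
    and fh: "\<And>w. cmod w = 1 \<Longrightarrow> cmod (f w * h w) \<le> m"
    and f0: "f 0 \<noteq> 0" and w: "cmod w < 1"
  shows "cmod (h w) \<le> m * exp (- ln (cmod (f 0)) * ((1 + cmod w) / (1 - cmod w)))"
  using hol(1) f1 fh f0
proof (induction "card {z. cmod z < 1 \<and> f z = 0}" arbitrary: f rule: less_induct)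
  case less
  show ?case
  proof (cases "\<exists>a. cmod a < 1 \<and> f a = 0")
    case False
    then show ?thesis
      using quotient_bound_zero_free[OF R less.prems(1) hol(2) less.prems(2,3) _ w] by blast
  next
    case True
    then obtain a where a: "cmod a < 1" "f a = 0" by blast
    obtain g n where g: "g holomorphic_on ball 0 R" "g a \<noteq> 0" "0 < n"
        "\<And>z. z \<in> ball 0 R \<Longrightarrow> f z = (z - a) ^ n * g z"
      by (rule holomorphic_factor_out_zero[OF less.prems(1), of a 0]) (use a R less.prems in auto)
    \<comment> \<open>\<open>k\<close> is \<open>f\<close> divided by the \<open>n\<close>-th power
      of the Blaschke factor of \<open>a\<close>, multiplied out so that it is visibly holomorphic
      on \<open>ball 0 R\<close>. The new factor has no zero in the unit disc, so \<open>k\<close>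
      loses the zero \<open>a\<close> and gains none.\<close>
    define k where "k z = (1 - cnj a * z) ^ n * g z" for z
    have fin: "finite {z. cmod z < 1 \<and> f z = 0}"
    proof (rule finite_subset)
      show "finite {z \<in> cball 0 1. f z = 0}"
      proof (rule holomorphic_compact_finite_zeros[OF less.prems(1)])
        have "0 \<in> ball 0 R" "a \<in> ball 0 R" using R a by auto
        then show "\<not> f constant_on ball 0 R"
          using less.prems(4) a(2) by (metis constant_on_def)
      qed (use R in auto)
    qed auto
    have ne: "1 - cnj a * z \<noteq> 0" if "cmod z < 1" for z
    proof
      assume "1 - cnj a * z = 0"
      then have "cmod (cnj a * z) = 1" by simp
      then have "cmod a * cmod z = 1" by (simp add: norm_mult)
      moreover have "cmod a * cmod z \<le> cmod a * 1" using that by (intro mult_left_mono) auto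
      ultimately show False using a by simp
    qed
    have "{z. cmod z < 1 \<and> k z = 0} \<subset> {z. cmod z < 1 \<and> f z = 0}"
    proof
      show "{z. cmod z < 1 \<and> k z = 0} \<subseteq> {z. cmod z < 1 \<and> f z = 0}"
        using g(4) ne R by (auto simp: k_def)
      show "{z. cmod z < 1 \<and> k z = 0} \<noteq> {z. cmod z < 1 \<and> f z = 0}"
        using a g(2) ne[OF a(1)] by (auto simp: k_def set_eq_iff)
    qed
    then have card: "card {z. cmod z < 1 \<and> k z = 0} < card {z. cmod z < 1 \<and> f z = 0}"
      using fin psubset_card_mono by blast
    have k_eq: "cmod (k z) = cmod (f z)" if "cmod z = 1" for z
      using norm_Blaschke_numerator[OF that, of a] g(4)[of z] that R
      by (simp add: k_def norm_mult norm_power)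
    have f0_eq: "f 0 = (- a) ^ n * k 0"
      using g(4)[of 0] R by (simp add: k_def)
    have k0: "k 0 \<noteq> 0" using f0_eq less.prems by auto
    have "cmod (f 0) \<le> 1 * cmod (k 0)"
      unfolding f0_eq norm_mult norm_power using a
      by (intro mult_right_mono) (auto intro: power_le_one)
    then have ln_le: "ln (cmod (f 0)) \<le> ln (cmod (k 0))"
      using less.prems k0 by simp
    have m0: "m \<ge> 0" by (rule order_trans[OF norm_ge_zero less.prems(3)[of 1]]) simp
    have "cmod (h w) \<le> m * exp (- ln (cmod (k 0)) * ((1 + cmod w) / (1 - cmod w)))"
    proof (rule less.hyps[OF card])
      show "k holomorphic_on ball 0 R" unfolding k_def by (intro holomorphic_intros g)
    qed (use k_eq k0 less.prems in \<open>auto simp: norm_mult\<close>)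
    also have "\<dots> \<le> m * exp (- ln (cmod (f 0)) * ((1 + cmod w) / (1 - cmod w)))"
    proof (intro mult_left_mono m0 iffD2[OF exp_le_cancel_iff] mult_right_mono)
      show "0 \<le> (1 + cmod w) / (1 - cmod w)" using w by (intro divide_nonneg_nonneg) auto
    qed (use ln_le in auto)
    finally show ?thesis .
  qed
qed

section \<open>The log log theorem\<close>

text \<open>The product of four rotated copies of \<open>H\<close> replaces the mean of the subharmonic function \<open>ln |H|\<close>.\<close>

lemma four_point_mean:
  assumes hol: "H holomorphic_on UNIV" and r: "r > 0" and K: "K > 0"
    and up: "\<And>z. dist z0 z = r \<Longrightarrow> cmod (H z) \<le> exp (9 / 8 * K)"
    and low: "\<And>\<zeta>. cmod \<zeta> = r \<Longrightarrow> \<exists>k<4::nat. cmod (H (z0 + \<i> ^ k * \<zeta>)) \<le> exp (K / 2)"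
  shows "cmod (H z0) < exp K"
proof -
  define Q where "Q \<zeta> = (\<Prod>k<4::nat. H (z0 + \<i> ^ k * \<zeta>))" for \<zeta>
  have holQ: "Q holomorphic_on UNIV"
    unfolding Q_def
    by (intro holomorphic_on_prod holomorphic_on_compose_gen[OF _ hol, unfolded o_def] holomorphic_intros) auto
  have bound: "cmod (Q \<zeta>) \<le> exp (31 / 8 * K)" if \<zeta>: "cmod \<zeta> = r" for \<zeta>
  proof -
    obtain k0 where k0: "k0 < 4" "cmod (H (z0 + \<i> ^ k0 * \<zeta>)) \<le> exp (K / 2)"
      using low[OF \<zeta>] by blast
    have "cmod (Q \<zeta>) = cmod (H (z0 + \<i> ^ k0 * \<zeta>)) * (\<Prod>k\<in>{..<4} - {k0}. cmod (H (z0 + \<i> ^ k * \<zeta>)))"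
      unfolding Q_def prod_norm[symmetric] using k0 by (subst prod.remove[of _ k0]) auto
    also have "\<dots> \<le> exp (K / 2) * (\<Prod>k\<in>{..<4} - {k0}. exp (9 / 8 * K))"
      using k0 \<zeta> by (intro mult_mono prod_mono conjI up prod_nonneg) (auto simp: dist_norm norm_mult norm_power)
    also have "(\<Prod>k\<in>{..<4} - {k0}. exp (9 / 8 * K)) = exp (9 / 8 * K) ^ 3"
      using k0 by simp
    also have "exp (K / 2) * exp (9 / 8 * K) ^ 3 = exp (31 / 8 * K)"
      by (simp flip: exp_of_nat_mult exp_add)
    finally show ?thesis .
  qed
  have "cmod (Q 0) \<le> exp (31 / 8 * K)"
  proof (rule maximum_modulus_frontier[of Q "ball 0 r"])
    show "Q holomorphic_on interior (ball 0 r)" "continuous_on (closure (ball 0 r)) Q"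
      using holQ by (auto intro: holomorphic_on_subset continuous_on_subset dest: holomorphic_on_imp_continuous_on)
  qed (use r bound in auto)
  \<comment> \<open>\<open>31 / 8 = 1 / 2 + 3 * 9 / 8\<close>: one small factor outweighs the excess
    of the other three, as the fourth root leaves \<open>31 / 32 < 1\<close>.\<close>
  also have "Q 0 = H z0 ^ 4" by (simp add: Q_def)
  finally have "cmod (H z0) ^ 4 \<le> exp (31 / 32 * K) ^ 4"
    by (simp add: norm_power flip: exp_of_nat_mult)
  then have "cmod (H z0) \<le> exp (31 / 32 * K)"
    by (rule power_le_imp_le_base[of _ 3, simplified]) auto
  also have "\<dots> < exp K" using K by simp
  finally show ?thesis .
qed

text \<open>One coordinate of \<zeta> exceeds \<open>r / 2\<close> in modulus, and two of the four
  rotations move the imaginary part of \<open>z0\<close> up and down by that coordinate.\<close>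

lemma rotated_point_off_lines:
  assumes r: "0 < r" "r \<le> \<rho> / 2" and \<zeta>: "cmod \<zeta> = r"
  obtains k where "k < (4::nat)" "\<bar>\<bar>Im (z0 + \<i> ^ k * \<zeta>)\<bar> - \<rho>\<bar> \<ge> r / 2"
proof -
  \<comment> \<open>Two points \<open>y + s\<close>, \<open>y - s\<close> within
    \<open>r / 2\<close> of the lines could not belong to the same line, being
    \<open>2 |s| > r\<close> apart, nor to opposite lines, since
    \<open>2 |s| \<le> 2 r < 2 \<rho> - r\<close>.\<close>
  have key: "\<bar>\<bar>y + s\<bar> - \<rho>\<bar> \<ge> r / 2 \<or> \<bar>\<bar>y - s\<bar> - \<rho>\<bar> \<ge> r / 2" if "\<bar>s\<bar> > r / 2" "\<bar>s\<bar> \<le> r" for s y :: real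
    using that r by (auto simp: abs_if split: if_splits)
  have le: "\<bar>Re \<zeta>\<bar> \<le> r" "\<bar>Im \<zeta>\<bar> \<le> r"
    using \<zeta> abs_Re_le_cmod[of \<zeta>] abs_Im_le_cmod[of \<zeta>] by auto
  have "\<bar>Re \<zeta>\<bar> > r / 2 \<or> \<bar>Im \<zeta>\<bar> > r / 2"
  proof (rule ccontr)
    assume "\<not> ?thesis"
    then have "(Re \<zeta>)\<^sup>2 \<le> (r / 2)\<^sup>2" "(Im \<zeta>)\<^sup>2 \<le> (r / 2)\<^sup>2"
      using r by (auto simp: abs_le_square_iff[symmetric])
    then have "r\<^sup>2 \<le> 2 * (r / 2)\<^sup>2" using cmod_power2[of \<zeta>] \<zeta> by simp
    then show False using r by (simp add: power2_eq_square)
  qed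
  then show thesis
  proof
    assume "\<bar>Re \<zeta>\<bar> > r / 2"
    from key[OF this le(1), of "Im z0"] show thesis
      using that[of 1] that[of 3] by (auto simp: numeral_eq_Suc)
  next
    assume "\<bar>Im \<zeta>\<bar> > r / 2"
    from key[OF this le(2), of "Im z0"] show thesis
      using that[of 0] that[of 2] by auto
  qed
qed

text \<open>A quantitative form of the Levinson--Domar \<open>log log\<close> theorem: a point where \<open>ln |H|\<close> is at
  least \<open>2 A (9/8)\<^sup>j\<close> forces, within distance \<open>2 e j\<close>, a point where it is at least
  \<open>2 A (9/8)\<^bsup>j+1\<^esup>\<close>; as the distances are summable, \<open>H\<close> would be unbounded on a compact set.\<close>

lemma Domar_two_lines:
  fixes e :: "nat \<Rightarrow> real"
  assumes \<rho>: "\<rho> > 0" and e: "summable e" "\<And>j. e j > 0"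
    and m: "\<And>j d. 0 < d \<Longrightarrow> d \<le> \<rho> + 2 \<Longrightarrow> m d > (9 / 8) ^ j \<Longrightarrow> d < e j"
  obtains K where "K > 0" "\<And>H t A y. \<lbrakk>H holomorphic_on UNIV; A > 0;
    \<And>z. \<lbrakk>\<bar>Re z - t\<bar> \<le> 1; \<bar>Im z\<bar> \<le> \<rho> + 2; \<bar>Im z\<bar> \<noteq> \<rho>\<rbrakk> \<Longrightarrow> cmod (H z) \<le> exp (A * m \<bar>\<bar>Im z\<bar> - \<rho>\<bar>);
    \<bar>y\<bar> \<le> \<rho> + 1\<rbrakk> \<Longrightarrow> cmod (H (Complex t y)) \<le> exp (K * A)"
proof -
  \<comment> \<open>\<sigma> bounds the total displacement: \<open>\<sigma> \<le> 1\<close> keeps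
    all points where the bound on \<open>H\<close> is assumed, and
    \<open>\<sigma> \<le> \<rho> / 2\<close> keeps the radii admissible for
    \<open>rotated_point_off_lines\<close>.\<close>
  define \<sigma> where "\<sigma> = min 1 (\<rho> / 2)"
  have \<sigma>: "\<sigma> > 0" "\<sigma> \<le> 1" "\<sigma> \<le> \<rho> / 2" using \<rho> by (auto simp: \<sigma>_def)
  obtain J where J: "\<And>n k. n \<ge> J \<Longrightarrow> \<bar>sum e {n..<k}\<bar> < \<sigma> / 2"
    using e(1) \<sigma> unfolding summable_Cauchy by (metis half_gt_zero real_norm_def)
  define S where "S j = 2 * sum e {J..<j}" for j
  have S: "S j \<le> \<sigma>" for j using J[of J j] by (auto simp: S_def)
  have S_Suc: "S (Suc j) = S j + 2 * e j" if "j \<ge> J" for j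
    using that by (simp add: S_def)
  have ej: "2 * e j \<le> \<sigma>" if "j \<ge> J" for j
    using J[OF that, of "Suc j"] by simp
  have main: "cmod (H (Complex t y)) \<le> exp (2 * (9 / 8) ^ J * A)"
    if hol: "H holomorphic_on UNIV" and A: "A > 0"
      and le: "\<And>z. \<lbrakk>\<bar>Re z - t\<bar> \<le> 1; \<bar>Im z\<bar> \<le> \<rho> + 2; \<bar>Im z\<bar> \<noteq> \<rho>\<rbrakk> \<Longrightarrow> cmod (H z) \<le> exp (A * m \<bar>\<bar>Im z\<bar> - \<rho>\<bar>)"
      and y: "\<bar>y\<bar> \<le> \<rho> + 1" for H t A y
  proof -
    define R where "R j = cbox (Complex (t - S j) (- \<rho> - 1 - S j)) (Complex (t + S j) (\<rho> + 1 + S j))" for j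
    have R: "z \<in> R j \<longleftrightarrow> \<bar>Re z - t\<bar> \<le> S j \<and> \<bar>Im z\<bar> \<le> \<rho> + 1 + S j" for z j
      by (auto simp: R_def in_cbox_complex_iff)
    \<comment> \<open>\<open>P\<close> is proved by descending induction: compactness gives it for
      one large index, and each step shrinks the rectangle and lowers the exponent by the factor
      \<open>9 / 8\<close>.\<close>
    define P where "P j \<longleftrightarrow> (\<forall>z\<in>R j. cmod (H z) \<le> exp (2 * A * (9 / 8) ^ j))" for j
    define X where "X = cbox (Complex (t - 1) (- \<rho> - 2)) (Complex (t + 1) (\<rho> + 2))"
    have RX: "R j \<subseteq> X" for j
      using S[of j] \<sigma> by (auto simp: X_def R in_cbox_complex_iff)
    have "compact (H ` X)"
      using hol by (intro compact_continuous_image continuous_on_subset[OF holomorphic_on_imp_continuous_on]) (auto simp: X_def)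
    then obtain B where B: "\<And>z. z \<in> X \<Longrightarrow> cmod (H z) \<le> B"
      using compact_imp_bounded bounded_iff by (metis imageI)
    obtain n0 where n0: "(9 / 8) ^ n0 > B / (2 * A)"
      using real_arch_pow[of "9 / 8" "B / (2 * A)"] by auto
    define n where "n = max n0 J"
    have "(9 / 8 :: real) ^ n0 \<le> (9 / 8) ^ n" by (intro power_increasing) (auto simp: n_def)
    with n0 have "B / (2 * A) \<le> (9 / 8) ^ n" by linarith
    with A have n: "n \<ge> J" "2 * A * (9 / 8) ^ n \<ge> B"
      by (auto simp: n_def pos_divide_le_eq mult.commute)
    have Pn: "P n"
      unfolding P_def
    proof
      fix z assume "z \<in> R n"
      then have "cmod (H z) \<le> B" using RX B by blast
      also have "\<dots> \<le> 1 + 2 * A * (9 / 8) ^ n" using n by simp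
      also have "\<dots> \<le> exp (2 * A * (9 / 8) ^ n)" by (rule exp_ge_add_one_self)
      finally show "cmod (H z) \<le> exp (2 * A * (9 / 8) ^ n)" .
    qed
    have step: "P j" if "j \<ge> J" "P (Suc j)" for j
      unfolding P_def
    proof
      fix z0 assume z0: "z0 \<in> R j"
      \<comment> \<open>With radius \<open>2 * e j\<close>, some rotated point is at least
        \<open>e j\<close> away from both lines, where \<open>m\<close> is at most
        \<open>(9 / 8) ^ j\<close>. This gives half of the exponent, as
        \<open>four_point_mean\<close> requires.\<close>
      define r where "r = 2 * e j"
      have r: "r > 0" "r \<le> \<sigma>" using e(2)[of j] ej[OF that(1)] by (auto simp: r_def)
      have near: "z \<in> R (Suc j)" if "dist z0 z = r" for z
      proof -
        have "\<bar>Re z - Re z0\<bar> \<le> r" "\<bar>Im z - Im z0\<bar> \<le> r"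
          using that abs_Re_le_cmod[of "z - z0"] abs_Im_le_cmod[of "z - z0"]
          by (auto simp: dist_norm norm_minus_commute)
        then show ?thesis
          using z0 S_Suc[OF \<open>j \<ge> J\<close>] by (auto simp: R r_def)
      qed
      have "cmod (H z0) < exp (2 * A * (9 / 8) ^ j)"
      proof (rule four_point_mean[OF hol r(1)])
        show "0 < 2 * A * (9 / 8) ^ j" using A by simp
        show "cmod (H z) \<le> exp (9 / 8 * (2 * A * (9 / 8) ^ j))" if "dist z0 z = r" for z
          using \<open>P (Suc j)\<close> near[OF that] by (simp add: P_def mult_ac)
        fix \<zeta> assume \<zeta>: "cmod \<zeta> = r"
        obtain k where k: "k < 4" "\<bar>\<bar>Im (z0 + \<i> ^ k * \<zeta>)\<bar> - \<rho>\<bar> \<ge> r / 2"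
          using rotated_point_off_lines[OF r(1) order_trans[OF r(2) \<sigma>(3)] \<zeta>] by blast
        define z where "z = z0 + \<i> ^ k * \<zeta>"
        have "z \<in> R (Suc j)" using \<zeta> by (intro near) (simp add: z_def dist_norm norm_mult norm_power)
        then have zR: "\<bar>Re z - t\<bar> \<le> 1" "\<bar>Im z\<bar> \<le> \<rho> + 2"
          using S[of "Suc j"] \<sigma> by (auto simp: R)
        have kz: "\<bar>\<bar>Im z\<bar> - \<rho>\<bar> \<ge> e j" using k by (simp add: z_def r_def)
        then have pos: "\<bar>\<bar>Im z\<bar> - \<rho>\<bar> > 0" using e(2)[of j] by linarith
        have "cmod (H z) \<le> exp (A * m \<bar>\<bar>Im z\<bar> - \<rho>\<bar>)"
          using zR pos by (intro le) auto
        also have "m \<bar>\<bar>Im z\<bar> - \<rho>\<bar> \<le> (9 / 8) ^ j"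
          using m[OF pos _, of j] kz zR(2) \<rho> by fastforce
        finally have "cmod (H z) \<le> exp (2 * A * (9 / 8) ^ j / 2)"
          using A by (simp add: mult_left_mono)
        then show "\<exists>k<4. cmod (H (z0 + \<i> ^ k * \<zeta>)) \<le> exp (2 * A * (9 / 8) ^ j / 2)"
          using k(1) z_def by blast
      qed
      then show "cmod (H z0) \<le> exp (2 * A * (9 / 8) ^ j)" by simp
    qed
    have "P J"
      using n(1) by (rule inc_induct) (use Pn step in auto)
    moreover have "Complex t y \<in> R J" using y by (simp add: R S_def)
    ultimately show ?thesis by (simp add: P_def mult_ac)
  qed
  show thesis
    by (rule that[of "2 * (9 / 8) ^ J"]) (use main in auto)
qed

text \<open>A layer-cake argument: as \<open>f\<close> decreases, \<open>c n\<close> is the length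
  of the part of \<open>(0, D]\<close> where \<open>f > b * n\<close>, and at each \<open>t\<close>
  the number of these intervals containing \<open>t\<close> is at most
  \<open>f t / b\<close>.\<close>

lemma summable_generalized_inverse:
  fixes f :: "real \<Rightarrow> real"
  assumes int: "f integrable_on {0<..}" and nonneg: "\<And>t. t > 0 \<Longrightarrow> f t \<ge> 0"
    and decr: "\<And>s t. 0 < s \<Longrightarrow> s \<le> t \<Longrightarrow> f t \<le> f s"
    and b: "b > 0" and D: "D > 0"
  obtains c :: "nat \<Rightarrow> real" where "summable c" "\<And>n. c n \<ge> 0"
    "\<And>n t. \<lbrakk>0 < t; t \<le> D; f t > b * real n\<rbrakk> \<Longrightarrow> t \<le> c n"
proof -
  \<comment> \<open>Inserting 0 keeps the set nonempty, so that its supremum is meaningful and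
    nonnegative.\<close>
  define X where "X n = insert 0 {t. 0 < t \<and> t \<le> D \<and> f t > b * real n}" for n :: nat
  define c where "c n = Sup (X n)" for n
  have bdd: "bdd_above (X n)" for n
    unfolding X_def by (intro bdd_aboveI[of _ D]) (use D in auto)
  have up: "t \<le> c n" if "t \<in> X n" for t n
    unfolding c_def by (rule cSup_upper[OF that bdd])
  have c0: "c n \<ge> 0" for n by (rule up) (simp add: X_def)
  \<comment> \<open>The sum starts at 1 because only the positive integers below
    \<open>f t / b\<close> number at most \<open>f t / b\<close>; the index 0 would add one.\<close>
  have count: "(\<Sum>n=1..k. if t \<in> {0<..<c n} then 1 else 0) \<le> f t / b" if t: "t > 0" for t k
  proof -
    have lt: "real n < f t / b" if n: "t < c n" for n
    proof -
      obtain t' where "t' \<in> X n" "t < t'"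
        using less_cSup_iff[OF _ bdd] n by (metis c_def X_def insert_not_empty)
      then have "f t' > b * real n" "t \<le> t'" using t by (auto simp: X_def)
      then have "f t > b * real n" using decr[of t t'] t by simp
      then show ?thesis using b by (simp add: field_simps)
    qed
    have "{n\<in>{1..k}. t < c n} \<subseteq> {1..nat \<lfloor>f t / b\<rfloor>}"
      using lt by (auto simp: le_nat_floor less_imp_le)
    then have "card {n\<in>{1..k}. t < c n} \<le> nat \<lfloor>f t / b\<rfloor>"
      using card_mono[of "{1..nat \<lfloor>f t / b\<rfloor>}"] by fastforce
    then have "real (card {n\<in>{1..k}. t < c n}) \<le> f t / b"
      using nonneg[OF t] b by (simp add: le_nat_iff le_floor_iff)
    moreover have "(\<Sum>n=1..k. if t \<in> {0<..<c n} then 1 else 0) = real (card {n\<in>{1..k}. t < c n})"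
      using t by (simp add: sum.If_cases Int_def)
    ultimately show ?thesis by simp
  qed
  have ind: "((\<lambda>t. if t \<in> {0<..<c n} then 1 else 0) has_integral c n) {0<..}" for n
  proof -
    have "((\<lambda>t. 1) has_integral c n) {0..c n}"
      using has_integral_const_real[of "1::real" 0 "c n"] c0[of n] by simp
    then have "((\<lambda>t. 1) has_integral c n) {0<..<c n}"
      by (simp add: has_integral_Icc_iff_Ioo)
    then show ?thesis
      by (subst has_integral_restrict) auto
  qed
  have bound: "(\<Sum>n=1..k. c n) \<le> integral {0<..} f / b" for k
  proof (rule has_integral_le)
    show "((\<lambda>t. \<Sum>n=1..k. if t \<in> {0<..<c n} then 1 else 0) has_integral (\<Sum>n=1..k. c n)) {0<..}"
      by (intro has_integral_sum ind) auto
    show "((\<lambda>t. f t / b) has_integral integral {0<..} f / b) {0<..}"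
      using integrable_integral[OF int] by (rule has_integral_divide)
  qed (use count in auto)
  have "summable (\<lambda>n. c (Suc n))"
  proof (rule summableI_nonneg_bounded)
    fix k show "(\<Sum>i<k. c (Suc i)) \<le> integral {0<..} f / b"
      using bound[of k] by (simp add: sum.atLeast1_atMost_eq)
  qed (use c0 in auto)
  then have "summable c" by (simp add: summable_Suc_iff)
  then show thesis
    using that[of c] c0 up by (auto simp: X_def)
qed

section \<open>Crosscut bounds\<close>

lemma sin_ge_chord:
  assumes "0 \<le> x" "x \<le> pi / 2"
  shows "sin x \<ge> 2 / pi * x"
proof -
  have "concave_on {0..pi / 2} sin"
  proof (rule f''_le0_imp_concave)
    show "(sin has_real_derivative cos x) (at x)" "(cos has_real_derivative - sin x) (at x)" for x :: real
      by (auto intro!: derivative_eq_intros)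
    show "- sin x \<le> 0" if "x \<in> {0..pi / 2}" for x :: real
      using that sin_ge_zero[of x] by auto
  qed auto
  then have "(1 - 2 / pi * x) * sin 0 + 2 / pi * x * sin (pi / 2)
      \<le> sin ((1 - 2 / pi * x) *\<^sub>R 0 + (2 / pi * x) *\<^sub>R (pi / 2))"
    using assms by (intro concave_onD) (auto simp: field_simps)
  then show ?thesis by simp
qed

text \<open>\<open>Ln q / a\<close> is the conformal map of the disc onto the strip fixing 0. The
  estimates pull weights in the strip back to circles: boundary distance shrinks at most linearly in
  \<open>1 - |w|\<close>, and the modulus is at most of order \<open>1 / (1 - |w|)\<close>.\<close>

lemma strip_of_disc:
  fixes w :: complex
  assumes \<rho>: "\<rho> > 0" and w: "cmod w < 1"
  defines "q \<equiv> (1 + w) / (1 - w)" and "a \<equiv> pi / (2 * \<rho>)"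
  shows "Re q > 0" and "\<bar>Im (Ln q / of_real a)\<bar> < \<rho>"
    and "\<rho> - \<bar>Im (Ln q / of_real a)\<bar> \<ge> (1 - cmod w) / (2 * a)"
    and "cmod (Ln q / of_real a) \<le> (2 / (1 - cmod w) + 2) / a"
proof -
  have a: "a > 0" "pi / 2 = a * \<rho>" using \<rho> by (auto simp: a_def)
  have ne: "1 - w \<noteq> 0" "1 + w \<noteq> 0" using w by (auto simp: add_eq_0_iff)
  have Req: "Re q = (1 - (cmod w)\<^sup>2) / (cmod (1 - w))\<^sup>2"
    unfolding q_def Re_divide cmod_power2 by (simp add: power2_eq_square algebra_simps)
  have "(cmod w)\<^sup>2 < 1" using w by (simp add: abs_square_less_1)
  then show Re_pos: "Re q > 0"
    using ne by (auto simp: Req)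
  then have q0: "q \<noteq> 0" by auto
  define \<theta> where "\<theta> = Im (Ln q)"
  have \<theta>: "\<bar>\<theta>\<bar> < pi / 2" unfolding \<theta>_def by (rule Re_Ln_pos_lt_imp[OF Re_pos])
  have Im_eq: "Im (Ln q / of_real a) = \<theta> / a" by (simp add: \<theta>_def)
  show "\<bar>Im (Ln q / of_real a)\<bar> < \<rho>"
    unfolding Im_eq using \<theta> a by (simp add: abs_divide field_simps)
  have "Re q = cmod q * cos \<theta>"
    using Re_exp[of "Ln q"] q0 by (simp add: \<theta>_def)
  then have cos_eq: "cos \<theta> = (1 - (cmod w)\<^sup>2) / (cmod (1 - w) * cmod (1 + w))"
  proof -
    assume eq: "Re q = cmod q * cos \<theta>"
    define u v where "u = cmod (1 - w)" and "v = cmod (1 + w)"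
    have uv: "u > 0" "v > 0" using ne by (auto simp: u_def v_def)
    have "(1 - (cmod w)\<^sup>2) / u\<^sup>2 = v / u * cos \<theta>"
      using eq unfolding Req by (simp add: q_def norm_divide u_def v_def)
    then have "u * (1 - (cmod w)\<^sup>2) = u * (cos \<theta> * (u * v))"
      using uv by (simp add: power2_eq_square divide_simps mult_ac split: if_splits)
    then have "1 - (cmod w)\<^sup>2 = cos \<theta> * (u * v)" using uv by simp
    then show ?thesis using uv by (simp add: u_def v_def)
  qed
  have nle: "cmod (1 - w) \<le> 1 + cmod w" "cmod (1 + w) \<le> 2"
    using norm_triangle_ineq4[of 1 w] norm_triangle_ineq[of 1 w] w by auto
  \<comment> \<open>As \<open>sin x \<le> x\<close>, a lower bound for \<open>cos \<theta>\<close>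
    is one for the angular distance \<open>pi / 2 - |\<theta>|\<close> to the boundary.\<close>
  have "(1 - cmod w) / 2 = (1 - (cmod w)\<^sup>2) / ((1 + cmod w) * 2)"
    by (simp add: power2_eq_square divide_simps) (simp add: algebra_simps add_nonneg_eq_0_iff)
  also have "\<dots> \<le> cos \<theta>"
    unfolding cos_eq using nle ne \<open>(cmod w)\<^sup>2 < 1\<close>
    by (intro divide_left_mono mult_mono mult_pos_pos) (auto simp: add_pos_nonneg)
  also have "cos \<theta> = sin (pi / 2 - \<bar>\<theta>\<bar>)" by (simp add: sin_diff)
  also have "\<dots> \<le> pi / 2 - \<bar>\<theta>\<bar>" using \<theta> by (intro sin_x_le_x) auto
  finally have "(1 - cmod w) / 2 \<le> a * \<rho> - \<bar>\<theta>\<bar>" using a by simp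
  then have "(1 - cmod w) / 2 / a \<le> (a * \<rho> - \<bar>\<theta>\<bar>) / a"
    using a by (intro divide_right_mono) auto
  then show "\<rho> - \<bar>Im (Ln q / of_real a)\<bar> \<ge> (1 - cmod w) / (2 * a)"
    unfolding Im_eq using a(1) by (simp add: abs_divide diff_divide_distrib)
  have q_le: "cmod q \<le> 2 / (1 - cmod w)"
    unfolding q_def norm_divide using nle norm_triangle_ineq2[of 1 w] w
    by (intro frac_le) auto
  have q_ge: "cmod q \<ge> (1 - cmod w) / 2"
    unfolding q_def norm_divide using nle norm_triangle_ineq2[of 1 "- w"] w ne
    by (intro frac_le) auto
  have "ln (cmod q) \<le> ln (2 / (1 - cmod w))"
    using q_le q0 w by (subst ln_le_cancel_iff) auto
  moreover have "ln (cmod q) \<ge> - ln (2 / (1 - cmod w))"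
    using q_ge q0 w by (subst ln_inverse[symmetric]) (auto simp: ln_le_cancel_iff)
  moreover have "ln (2 / (1 - cmod w)) \<le> 2 / (1 - cmod w)"
    using w by (intro ln_bound) auto
  ultimately have "\<bar>Re (Ln q)\<bar> \<le> 2 / (1 - cmod w)" using q0 by simp
  moreover have "\<bar>Im (Ln q)\<bar> \<le> 2" using \<theta> pi_less_4 by (simp add: \<theta>_def)
  ultimately have "cmod (Ln q) \<le> 2 / (1 - cmod w) + 2"
    using cmod_le[of "Ln q"] by linarith
  then show "cmod (Ln q / of_real a) \<le> (2 / (1 - cmod w) + 2) / a"
    using a by (simp add: norm_divide divide_right_mono)
qed

text \<open>The inverse map is \<open>(p - 1) / (p + 1)\<close> with \<open>p = exp (a z)\<close>.
  The distance to the circle comes from \<open>1 - |w|^2 = 4 Re p / |p + 1|^2\<close>: Jordan's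
  inequality bounds \<open>Re p\<close> below, and \<open>|Re z| \<le> 1\<close> bounds
  \<open>|p + 1|\<close> above.\<close>

lemma disc_of_strip:
  fixes z :: complex
  assumes \<rho>: "\<rho> > 0" and z: "\<bar>Re z\<bar> \<le> 1" "\<bar>Im z\<bar> < \<rho>"
  defines "a \<equiv> pi / (2 * \<rho>)"
  obtains w where "Ln ((1 + w) / (1 - w)) / of_real a = z"
    "1 - cmod w \<ge> 2 * exp (- a) / (\<rho> * (exp a + 1)\<^sup>2) * (\<rho> - \<bar>Im z\<bar>)"
proof -
  have a: "a > 0" "pi / 2 = a * \<rho>" using \<rho> by (auto simp: a_def)
  define p where "p = exp (of_real a * z)"
  define d where "d = \<rho> - \<bar>Im z\<bar>"
  have d: "0 < d" "d \<le> \<rho>" using z by (auto simp: d_def)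
  define w where "w = (p - 1) / (p + 1)"
  have Im_lt: "\<bar>a * Im z\<bar> < pi / 2" unfolding a(2) using z a by (simp add: abs_mult)
  have "cos (a * Im z) = cos \<bar>a * Im z\<bar>" by simp
  also have "\<bar>a * Im z\<bar> = pi / 2 - a * d" using a by (simp add: d_def abs_mult algebra_simps)
  also have "cos (pi / 2 - a * d) = sin (a * d)" by (simp add: cos_diff)
  also have "\<dots> \<ge> 2 / pi * (a * d)"
    using a d by (intro sin_ge_chord) (auto simp only: a(2) intro!: mult_left_mono mult_nonneg_nonneg)
  also have "2 / pi * (a * d) = d / \<rho>" using \<rho> by (simp add: a_def)
  finally have cos_ge: "d / \<rho> \<le> cos (a * Im z)" .
  have Re_p: "Re p \<ge> exp (- a) * (d / \<rho>)"
  proof -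
    have "exp (- a) * (d / \<rho>) \<le> exp (a * Re z) * cos (a * Im z)"
      using cos_ge d \<rho> a z by (intro mult_mono) (auto simp: abs_le_iff mult_left_mono[of "-1" "Re z" a, simplified])
    also have "\<dots> = Re p" by (simp add: p_def Re_exp)
    finally show ?thesis .
  qed
  have Re_pos: "Re p > 0"
    using Re_p d \<rho> by (smt (verit) divide_pos_pos exp_gt_zero mult_pos_pos)
  then have p1: "p + 1 \<noteq> 0" by (metis add.commute add_pos_pos one_complex.simps(1) plus_complex.simps(1) less_irrefl zero_complex.simps(1) zero_less_one)
  have q_eq: "(1 + w) / (1 - w) = p"
  proof -
    have "1 + w = 2 * p / (p + 1)" "1 - w = 2 / (p + 1)"
      using p1 by (auto simp: w_def field_simps)
    then show ?thesis using p1 by simp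
  qed
  have "Ln p = of_real a * z"
    unfolding p_def using Im_lt by (intro Ln_exp) (auto simp: abs_less_iff)
  then have "Ln ((1 + w) / (1 - w)) / of_real a = z" using a q_eq by simp
  moreover have "1 - cmod w \<ge> 2 * exp (- a) / (\<rho> * (exp a + 1)\<^sup>2) * (\<rho> - \<bar>Im z\<bar>)"
  proof -
    have w2: "1 - (cmod w)\<^sup>2 = 4 * Re p / (cmod (p + 1))\<^sup>2"
    proof -
      have "(cmod (p + 1))\<^sup>2 - (cmod (p - 1))\<^sup>2 = 4 * Re p"
        unfolding cmod_power2 by (simp add: power2_eq_square algebra_simps)
      moreover have "1 - (cmod w)\<^sup>2 = ((cmod (p + 1))\<^sup>2 - (cmod (p - 1))\<^sup>2) / (cmod (p + 1))\<^sup>2"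
        unfolding diff_divide_distrib using p1 by (simp add: w_def norm_divide power_divide)
      ultimately show ?thesis by simp
    qed
    have "a * Re z \<le> a * 1" using a z by (intro mult_left_mono) auto
    then have np: "cmod (p + 1) \<le> exp a + 1"
      using norm_triangle_ineq[of p 1] by (simp add: p_def norm_exp_eq_Re) (smt (verit) exp_le_cancel_iff)
    have "2 * (2 * exp (- a) / (\<rho> * (exp a + 1)\<^sup>2) * d) = 4 * (exp (- a) * (d / \<rho>)) / (exp a + 1)\<^sup>2"
      using \<rho> by (simp add: field_simps)
    also have "\<dots> \<le> 4 * Re p / (cmod (p + 1))\<^sup>2"
      using Re_p Re_pos np p1 d \<rho> by (intro frac_le power_mono) auto
    also have "\<dots> = (1 - cmod w) * (1 + cmod w)"
      unfolding w2[symmetric] by (simp add: power2_eq_square algebra_simps)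
    also have "\<dots> \<le> (1 - cmod w) * 2"
    proof -
      have "(cmod w)\<^sup>2 < 1" using w2 Re_pos p1 by (smt (verit) divide_pos_pos zero_less_norm_iff zero_less_power)
      then have "cmod w < 1" by (simp add: abs_square_less_1)
      then show ?thesis by (intro mult_left_mono) auto
    qed
    finally show ?thesis by (simp add: d_def)
  qed
  ultimately show thesis using that by blast
qed

section \<open>The weight \<open>M\<close> and bounds for \<open>H\<close> on a single
  crosscut\<close>

locale strip_weight =
  fixes \<rho> :: real and M :: "real \<Rightarrow> real"
  assumes rho_pos: "\<rho> > 0"
    and M_gt: "\<And>t. t > 0 \<Longrightarrow> M t > exp 1"
    and M_decr: "\<And>s t. 0 < s \<Longrightarrow> s \<le> t \<Longrightarrow> M t \<le> M s"
    and M_cont: "continuous_on {0<..} M"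
    and M_int: "(\<lambda>t. ln (ln (M t))) integrable_on {0<..}"
begin

definition crit :: real where "crit = pi / (2 * \<rho>)"

lemma crit_pos: "crit > 0" and crit_rho: "crit * \<rho> = pi / 2"
  using rho_pos by (auto simp: crit_def)

lemma M_pos: "t > 0 \<Longrightarrow> M t > 0"
  using M_gt[of t] exp_gt_zero[of "1::real"] by linarith

lemma ln_M_gt_one: "t > 0 \<Longrightarrow> ln (M t) > 1"
  using M_gt[of t] M_pos[of t] by (metis exp_less_cancel_iff exp_ln)

lemma ln_ln_M_pos: "t > 0 \<Longrightarrow> ln (ln (M t)) > 0"
  using ln_M_gt_one[of t] by simp

lemma ln_M_decr: "0 < s \<Longrightarrow> s \<le> t \<Longrightarrow> ln (M t) \<le> ln (M s)"
  using M_decr[of s t] M_pos[of s] M_pos[of t] by simp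

text \<open>Serves twice: with \<open>b = ln (9 / 8)\<close> for the radii in the log log theorem,
  and with the growth exponent \<open>b\<close> for the widths of the widened strip.\<close>

lemma ln_ln_M_inverse_summable:
  assumes "b > 0" "D > 0"
  obtains c :: "nat \<Rightarrow> real" where "summable c" "\<And>n. c n \<ge> 0"
    "\<And>n t. \<lbrakk>0 < t; t \<le> D; ln (ln (M t)) > b * real n\<rbrakk> \<Longrightarrow> t \<le> c n"
proof (rule summable_generalized_inverse[OF M_int _ _ assms])
  show "ln (ln (M t)) \<ge> 0" if "t > 0" for t using ln_ln_M_pos[OF that] by simp
  show "ln (ln (M t)) \<le> ln (ln (M s))" if "0 < s" "s \<le> t" for s t
    using ln_M_decr[OF that] ln_M_gt_one[of s] ln_M_gt_one[of t] that by simp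
qed (use that in blast)

text \<open>The strip is mapped to the unit disc with \<open>t\<close> going to the centre, and the quotient bound
  is used on a disc whose radius is half way between the image of \<open>z\<close> and the unit circle.\<close>

lemma inner_bound:
  fixes N :: nat
  obtains C c where "C > 0" "c > 0"
    "\<And>f H t A z. \<lbrakk>f holomorphic_on open_strip \<rho>; H holomorphic_on open_strip \<rho>;
      \<And>z. \<bar>Im z\<bar> < \<rho> \<Longrightarrow> cmod (f z) \<le> 1;
      \<And>z. \<bar>Im z\<bar> < \<rho> \<Longrightarrow> cmod (f z * H z) \<le> (1 + cmod z) ^ N * M (\<rho> - \<bar>Im z\<bar>);
      f (of_real t) \<noteq> 0; - ln (cmod (f (of_real t))) \<le> A; t \<ge> 0; A \<ge> 1; real N * ln (1 + t) \<le> A;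
      \<bar>Re z - t\<bar> \<le> 1; \<bar>Im z\<bar> < \<rho>\<rbrakk>
      \<Longrightarrow> cmod (H z) \<le> exp (A * (C / (\<rho> - \<bar>Im z\<bar>) + ln (M (c * (\<rho> - \<bar>Im z\<bar>)))))"
proof -
  define a where "a = crit"
  have a: "a > 0" and a_eq: "a = pi / (2 * \<rho>)" using crit_pos by (auto simp: a_def crit_def)
  define c1 where "c1 = 2 * exp (- a) / (\<rho> * (exp a + 1)\<^sup>2)"
  \<comment> \<open>\<open>c1\<close> is the constant of \<open>disc_of_strip\<close>. With
    \<open>s = c1 * d\<close>, the constant \<open>C\<close> collects \<open>4 / s\<close> from
    Harnack's inequality, \<open>1 / s\<close> from \<open>N * ln (1 + t)\<close> and
    \<open>6 N / (a s)\<close> from the remaining polynomial growth; \<open>c\<close> comes from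
    \<open>1 - r = s / 2\<close> and the factor \<open>1 / (2 a)\<close> in
    \<open>strip_of_disc\<close>.\<close>
  have c1: "c1 > 0"
    using rho_pos unfolding c1_def by (intro divide_pos_pos mult_pos_pos zero_less_power) (auto simp: add_pos_pos)
  define C where "C = (5 + 6 * real N / a) / c1"
  define c where "c = c1 / (4 * a)"
  have C: "C > 0" "c > 0" using a c1 by (auto simp: C_def c_def add_pos_nonneg)
  have main: "cmod (H z) \<le> exp (A * (C / (\<rho> - \<bar>Im z\<bar>) + ln (M (c * (\<rho> - \<bar>Im z\<bar>)))))"
    if holf: "f holomorphic_on open_strip \<rho>" and holH: "H holomorphic_on open_strip \<rho>"
      and f1: "\<And>z. \<bar>Im z\<bar> < \<rho> \<Longrightarrow> cmod (f z) \<le> 1"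
      and fH: "\<And>z. \<bar>Im z\<bar> < \<rho> \<Longrightarrow> cmod (f z * H z) \<le> (1 + cmod z) ^ N * M (\<rho> - \<bar>Im z\<bar>)"
      and ft: "f (of_real t) \<noteq> 0" and A: "- ln (cmod (f (of_real t))) \<le> A"
      and t: "t \<ge> 0" and A1: "A \<ge> 1" and AN: "real N * ln (1 + t) \<le> A"
      and z: "\<bar>Re z - t\<bar> \<le> 1" "\<bar>Im z\<bar> < \<rho>" for f H t A z
  proof -
    define d where "d = \<rho> - \<bar>Im z\<bar>"
    have d: "d > 0" using z by (simp add: d_def)
    define s where "s = c1 * d"
    obtain w where w: "Ln ((1 + w) / (1 - w)) / of_real a = z - of_real t" "1 - cmod w \<ge> s"
      using disc_of_strip[OF rho_pos, of "z - of_real t"] z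
      unfolding s_def c1_def d_def a_eq by auto
    have s: "s > 0" "s \<le> 1" using mult_pos_pos[OF c1 d] w(2) norm_ge_zero[of w] unfolding s_def by linarith+
    define r where "r = 1 - s / 2"
    have r: "r > 0" "r < 1" using s by (auto simp: r_def)
    define \<phi> where "\<phi> u = of_real t + Ln ((1 + u) / (1 - u)) / of_real a" for u :: complex
    have \<phi>_strip: "\<bar>Im (\<phi> u)\<bar> < \<rho>" and \<phi>_d: "\<rho> - \<bar>Im (\<phi> u)\<bar> \<ge> (1 - cmod u) / (2 * a)"
      and \<phi>_norm: "cmod (\<phi> u) \<le> t + (2 / (1 - cmod u) + 2) / a" and \<phi>_pos: "Re ((1 + u) / (1 - u)) > 0"
      if "cmod u < 1" for u
      using strip_of_disc[OF rho_pos that] t norm_triangle_ineq[of "of_real t" "Ln ((1 + u) / (1 - u)) / of_real a"]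
      by (auto simp: \<phi>_def a_eq)
    have rb: "cmod (of_real r * u) < 1" if "u \<in> ball 0 (1 / r)" for u
      using that r by (simp add: norm_mult field_simps)
    \<comment> \<open>The dilation by \<open>r\<close> gives functions on a disc of radius
      \<open>1 / r > 1\<close>, as \<open>quotient_bound_disc\<close> demands.\<close>
    have hol\<phi>: "(\<lambda>u. \<phi> (of_real r * u)) holomorphic_on ball 0 (1 / r)"
      unfolding \<phi>_def
    proof (intro holomorphic_intros)
      fix u :: complex assume u: "u \<in> ball 0 (1 / r)"
      show "(1 + of_real r * u) / (1 - of_real r * u) \<notin> \<real>\<^sub>\<le>\<^sub>0"
        using \<phi>_pos[OF rb[OF u]] by (auto simp: complex_nonpos_Reals_iff)
      show "1 - of_real r * u \<noteq> 0" using rb[OF u] by auto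
    qed (use a in auto)
    have comp: "(\<lambda>u. g (\<phi> (of_real r * u))) holomorphic_on ball 0 (1 / r)"
      if "g holomorphic_on open_strip \<rho>" for g
      using holomorphic_on_compose_gen[OF hol\<phi> that] \<phi>_strip rb
      by (force simp: o_def open_strip_def)
    define m where "m = ((1 + t) * exp ((4 / s + 2) / a)) ^ N * M (c * d)"
    have bnd: "cmod (f (\<phi> (of_real r * u)) * H (\<phi> (of_real r * u))) \<le> m" if u: "cmod u = 1" for u
    proof -
      define v where "v = \<phi> (of_real r * u)"
      have nu: "cmod (of_real r * u) = r" using u r by (simp add: norm_mult)
      have v: "\<bar>Im v\<bar> < \<rho>" "\<rho> - \<bar>Im v\<bar> \<ge> c * d" "cmod v \<le> t + (4 / s + 2) / a"
        using \<phi>_strip[of "of_real r * u"] \<phi>_d[of "of_real r * u"] \<phi>_norm[of "of_real r * u"] r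
        unfolding nu v_def by (auto simp: r_def s_def c_def field_simps)
      have "t * ((4 / s + 2) / a) \<ge> 0" using t s a by simp
      then have "1 + cmod v \<le> (1 + t) * (1 + (4 / s + 2) / a)"
        using v(3) unfolding distrib_left distrib_right by simp
      also have "\<dots> \<le> (1 + t) * exp ((4 / s + 2) / a)"
        using t by (intro mult_left_mono exp_ge_add_one_self) auto
      finally have "(1 + cmod v) ^ N \<le> ((1 + t) * exp ((4 / s + 2) / a)) ^ N"
        by (intro power_mono) auto
      moreover have "M (\<rho> - \<bar>Im v\<bar>) \<le> M (c * d)"
        using v C d by (intro M_decr) auto
      moreover have "M (\<rho> - \<bar>Im v\<bar>) \<ge> 0"
        using v M_pos[of "\<rho> - \<bar>Im v\<bar>"] by simp
      ultimately have "(1 + cmod v) ^ N * M (\<rho> - \<bar>Im v\<bar>) \<le> m"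
        unfolding m_def using t by (intro mult_mono) auto
      then show ?thesis using fH[OF v(1)] by (simp add: v_def)
    qed
    have wr: "cmod w \<le> 1 - s" using w by simp
    define w0 where "w0 = w / of_real r"
    have "cmod w < r" using wr s by (simp add: r_def)
    then have w0: "cmod w0 < 1" using r by (simp add: w0_def norm_divide)
    have \<phi>0: "\<phi> 0 = of_real t" by (simp add: \<phi>_def)
    have \<phi>w: "\<phi> (of_real r * w0) = z" using w(1) r by (simp add: \<phi>_def w0_def)
    have "cmod (H (\<phi> (of_real r * w0)))
        \<le> m * exp (- ln (cmod (f (\<phi> (of_real r * 0)))) * ((1 + cmod w0) / (1 - cmod w0)))"
    proof (rule quotient_bound_disc[OF _ comp[OF holf] comp[OF holH] _ bnd _ w0])
      show "1 < 1 / r" using r by simp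
      show "cmod (f (\<phi> (of_real r * u))) \<le> 1" if "cmod u = 1" for u
        using that r by (intro f1 \<phi>_strip) (simp add: norm_mult)
    qed (use ft \<phi>0 in auto)
    then have "cmod (H z) \<le> m * exp (- ln (cmod (f (of_real t))) * ((1 + cmod w0) / (1 - cmod w0)))"
      using \<phi>0 \<phi>w by simp
    also have "\<dots> \<le> m * exp (A * (4 / s))"
    proof -
      have "(1 + cmod w0) / (1 - cmod w0) = (r + cmod w) / (r - cmod w)"
        using r by (simp add: w0_def norm_divide divide_simps)
      also have "\<dots> \<le> 2 / (s / 2)"
        using wr r s by (intro frac_le) (auto simp: r_def)
      finally have q: "(1 + cmod w0) / (1 - cmod w0) \<le> 4 / s" by simp
      have "0 \<le> (1 + cmod w0) / (1 - cmod w0)" using w0 by (intro divide_nonneg_nonneg) auto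
      then have "- ln (cmod (f (of_real t))) * ((1 + cmod w0) / (1 - cmod w0)) \<le> A * (4 / s)"
        using q A A1 by (intro mult_mono) auto
      moreover have "m \<ge> 0" using M_pos[of "c * d"] C d t by (simp add: m_def)
      ultimately show ?thesis by (intro mult_left_mono) auto
    qed
    also have "m = exp (real N * ln (1 + t) + real N * ((4 / s + 2) / a) + ln (M (c * d)))"
      using M_pos[of "c * d"] C d t
      by (simp add: m_def exp_add power_mult_distrib flip: exp_of_nat_mult)
         (simp add: exp_of_nat_mult)
    also have "\<dots> * exp (A * (4 / s)) \<le> exp (A * (C / d + ln (M (c * d))))"
    proof -
      have L: "ln (M (c * d)) \<le> A * ln (M (c * d))"
        using A1 ln_M_gt_one[of "c * d"] C d by simp
      have s1: "1 \<le> 1 / s" using s by simp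
      have "real N * ((4 / s + 2) / a) \<le> real N * ((4 / s + 2 * (1 / s)) / a)"
        using s1 a by (intro mult_left_mono divide_right_mono add_left_mono) auto
      also have "\<dots> = 6 * real N / a * (1 / s)" by (simp add: field_simps)
      also have "\<dots> \<le> A * (6 * real N / a * (1 / s))"
        using a s mult_right_mono[OF A1, of "6 * real N / a * (1 / s)"] by simp
      finally have "real N * ln (1 + t) + real N * ((4 / s + 2) / a) + A * (4 / s)
          \<le> A * (1 / s) + A * (6 * real N / a * (1 / s)) + A * (4 / s)"
        using AN A1 s1 mult_left_mono[of 1 "1 / s" A] by linarith
      also have "\<dots> = A * ((5 + 6 * real N / a) / s)"
        by (simp add: algebra_simps add_divide_distrib)
      also have "(5 + 6 * real N / a) / s = C / d"
        by (simp add: C_def s_def)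
      finally show ?thesis using L by (simp add: algebra_simps flip: exp_add)
    qed
    finally show ?thesis by (simp add: d_def)
  qed
  show thesis
    by (rule that[OF C]) (rule main)
qed

text \<open>The inner bound and the hypothesis outside the strip are put under one weight
  \<open>m d = C / d + ln (M (c * d))\<close>, to which \<open>Domar_two_lines\<close>
  applies.\<close>

lemma crosscut_bound:
  fixes N :: nat
  obtains K where "K > 0"
    "\<And>f H t A y. \<lbrakk>f holomorphic_on open_strip \<rho>; H holomorphic_on UNIV;
      \<And>z. \<bar>Im z\<bar> < \<rho> \<Longrightarrow> cmod (f z) \<le> 1;
      \<And>z. \<bar>Im z\<bar> < \<rho> \<Longrightarrow> cmod (f z * H z) \<le> (1 + cmod z) ^ N * M (\<rho> - \<bar>Im z\<bar>);
      \<And>z. \<bar>Im z\<bar> > \<rho> \<Longrightarrow> cmod (H z) \<le> (1 + cmod z) ^ N * M (\<bar>Im z\<bar> - \<rho>);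
      f (of_real t) \<noteq> 0; - ln (cmod (f (of_real t))) \<le> A; t \<ge> 0; A \<ge> 1; real N * ln (1 + t) \<le> A;
      \<bar>y\<bar> \<le> \<rho> + 1\<rbrakk>
      \<Longrightarrow> cmod (H (Complex t y)) \<le> exp (K * A)"
proof -
  obtain C0 c0 where C0: "C0 > 0" "c0 > 0" and inner:
    "\<And>f H t A z. \<lbrakk>f holomorphic_on open_strip \<rho>; H holomorphic_on open_strip \<rho>;
      \<And>z. \<bar>Im z\<bar> < \<rho> \<Longrightarrow> cmod (f z) \<le> 1;
      \<And>z. \<bar>Im z\<bar> < \<rho> \<Longrightarrow> cmod (f z * H z) \<le> (1 + cmod z) ^ N * M (\<rho> - \<bar>Im z\<bar>);
      f (of_real t) \<noteq> 0; - ln (cmod (f (of_real t))) \<le> A; t \<ge> 0; A \<ge> 1; real N * ln (1 + t) \<le> A;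
      \<bar>Re z - t\<bar> \<le> 1; \<bar>Im z\<bar> < \<rho>\<rbrakk>
      \<Longrightarrow> cmod (H z) \<le> exp (A * (C0 / (\<rho> - \<bar>Im z\<bar>) + ln (M (c0 * (\<rho> - \<bar>Im z\<bar>)))))"
    using inner_bound[of N] by metis
  \<comment> \<open>\<open>C1\<close> covers the bounded part of the polynomial factor outside the
    strip. There \<open>d \<le> 2\<close>, so the summand \<open>2 * C1\<close> of \<open>C\<close>
    yields \<open>C1 \<le> C / d\<close>.\<close>
  define C1 where "C1 = 1 + real N * (\<rho> + 3)"
  define C where "C = C0 + 2 * C1"
  define c where "c = min 1 c0"
  have C1: "C1 \<ge> 1" using rho_pos by (simp add: C1_def)
  have Cc: "C > 0" "C \<ge> C0" "c > 0" "c \<le> 1" "c \<le> c0" using C0 C1 by (auto simp: C_def c_def)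
  define m where "m d = C / d + ln (M (c * d))" for d
  obtain b :: "nat \<Rightarrow> real" where b: "summable b" "\<And>n. b n \<ge> 0"
    "\<And>n t. \<lbrakk>0 < t; t \<le> c * (\<rho> + 2); ln (ln (M t)) > ln (9 / 8) * real n\<rbrakk> \<Longrightarrow> t \<le> b n"
  proof (rule ln_ln_M_inverse_summable)
    show "ln (9 / 8 :: real) > 0" "c * (\<rho> + 2) > 0" using Cc rho_pos by auto
  qed blast
  \<comment> \<open>The first summand makes \<open>C / d\<close> at most half of
    \<open>(9 / 8) ^ j\<close>, so \<open>ln M\<close> must exceed the other half; the second
    excludes this. Halving costs six indices because \<open>(9 / 8) ^ 6 > 2\<close>. For
    \<open>j < 6\<close> the truncated difference is 0, a level that \<open>ln ln M\<close> always
    exceeds.\<close>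
  define e where "e j = 2 * C * (8 / 9) ^ j + b (j - 6) / c + (8 / 9) ^ j" for j :: nat
  have sum6: "summable (\<lambda>j. b (j - 6))"
    using b(1) by (subst summable_iff_shift[of _ 6, symmetric]) simp
  have e: "summable e" unfolding e_def
    by (intro summable_add summable_mult summable_divide sum6 summable_geometric) auto
  have e0: "e j > 0" for j
    using Cc b(2)[of "j - 6"] by (simp add: e_def add_nonneg_pos)
  have m: "d < e j" if d: "0 < d" "d \<le> \<rho> + 2" and mj: "m d > (9 / 8) ^ j" for j d
  proof (rule ccontr)
    assume "\<not> d < e j"
    moreover have "(8 / 9 :: real) ^ j > 0" "C * (8 / 9) ^ j > 0" using Cc by auto
    ultimately have d1: "d \<ge> 2 * C * (8 / 9) ^ j" and d2: "d > b (j - 6) / c"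
      using divide_nonneg_pos[OF b(2)[of "j - 6"] Cc(3)] unfolding e_def by linarith+
    have inv: "(8 / 9 :: real) ^ j * (9 / 8) ^ j = 1" by (simp flip: power_mult_distrib)
    have "2 * C = 2 * C * (8 / 9) ^ j * (9 / 8) ^ j" using inv by simp
    also have "\<dots> \<le> d * (9 / 8) ^ j" using d1 by (intro mult_right_mono) auto
    finally have "C / d \<le> (9 / 8) ^ j / 2" using d by (simp add: field_simps)
    then have big: "ln (M (c * d)) > (9 / 8) ^ j / 2" using mj unfolding m_def by linarith
    have "ln (ln (M (c * d))) > ln (9 / 8) * real (j - 6)"
    proof (cases "j \<ge> 6")
      case True
      have "(9 / 8 :: real) ^ j = (9 / 8) ^ (j - 6) * (9 / 8) ^ 6"
        using True by (simp flip: power_add)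
      also have "\<dots> \<ge> (9 / 8) ^ (j - 6) * 2"
        by (intro mult_left_mono) (auto simp: power_divide)
      finally have "ln (M (c * d)) > (9 / 8) ^ (j - 6)" using big by simp
      then have "ln (ln (M (c * d))) > ln ((9 / 8) ^ (j - 6))"
        by (subst ln_less_cancel_iff) (auto intro: less_trans[rotated])
      then show ?thesis by (simp add: ln_realpow mult.commute)
    next
      case False
      then show ?thesis using ln_ln_M_pos[of "c * d"] Cc d by simp
    qed
    then have "c * d \<le> b (j - 6)" using d Cc by (intro b(3)) auto
    then show False using d2 Cc by (simp add: field_simps)
  qed
  show thesis
  proof (rule Domar_two_lines[of \<rho> e m, OF rho_pos e e0])
    show "d < e j" if "0 < d" "d \<le> \<rho> + 2" "m d > (9 / 8) ^ j" for j d
      using m that by blast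
  next
    fix K assume K: "K > 0" "\<And>H t A y. \<lbrakk>H holomorphic_on UNIV; A > 0;
    \<And>z. \<lbrakk>\<bar>Re z - t\<bar> \<le> 1; \<bar>Im z\<bar> \<le> \<rho> + 2; \<bar>Im z\<bar> \<noteq> \<rho>\<rbrakk> \<Longrightarrow> cmod (H z) \<le> exp (A * m \<bar>\<bar>Im z\<bar> - \<rho>\<bar>);
    \<bar>y\<bar> \<le> \<rho> + 1\<rbrakk> \<Longrightarrow> cmod (H (Complex t y)) \<le> exp (K * A)"
    show thesis
    proof (rule that[OF K(1)])
      fix f H t A y
      assume holf: "f holomorphic_on open_strip \<rho>" and holH: "H holomorphic_on UNIV"
        and f1: "\<And>z. \<bar>Im z\<bar> < \<rho> \<Longrightarrow> cmod (f z) \<le> 1"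
        and fH: "\<And>z. \<bar>Im z\<bar> < \<rho> \<Longrightarrow> cmod (f z * H z) \<le> (1 + cmod z) ^ N * M (\<rho> - \<bar>Im z\<bar>)"
        and out: "\<And>z. \<bar>Im z\<bar> > \<rho> \<Longrightarrow> cmod (H z) \<le> (1 + cmod z) ^ N * M (\<bar>Im z\<bar> - \<rho>)"
        and ft: "f (of_real t) \<noteq> 0" and A: "- ln (cmod (f (of_real t))) \<le> A"
        and t: "t \<ge> 0" and A1: "A \<ge> 1" and AN: "real N * ln (1 + t) \<le> A" and y: "\<bar>y\<bar> \<le> \<rho> + 1"
      show "cmod (H (Complex t y)) \<le> exp (K * A)"
      proof (rule K(2)[OF holH _ _ y])
        fix z assume z: "\<bar>Re z - t\<bar> \<le> 1" "\<bar>Im z\<bar> \<le> \<rho> + 2" "\<bar>Im z\<bar> \<noteq> \<rho>"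
        define d where "d = \<bar>\<bar>Im z\<bar> - \<rho>\<bar>"
        have d: "d > 0" using z by (simp add: d_def)
        show "cmod (H z) \<le> exp (A * m \<bar>\<bar>Im z\<bar> - \<rho>\<bar>)"
        proof (cases "\<bar>Im z\<bar> < \<rho>")
          case True
          then have d_eq: "d = \<rho> - \<bar>Im z\<bar>" by (simp add: d_def)
          have "cmod (H z) \<le> exp (A * (C0 / d + ln (M (c0 * d))))"
            unfolding d_eq
            by (rule inner[OF holf holomorphic_on_subset[OF holH] f1 fH ft A t A1 AN z(1) True]) auto
          also have "\<dots> \<le> exp (A * m d)"
            unfolding m_def using A1 d Cc
            by (auto intro!: mult_left_mono add_mono divide_right_mono ln_M_decr mult_right_mono)
          finally show ?thesis by (simp add: d_def)
        next
          case False
          then have d_eq: "d = \<bar>Im z\<bar> - \<rho>" "\<bar>Im z\<bar> > \<rho>" using z by (auto simp: d_def)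
          have d2: "d \<le> 2" using z d_eq by simp
          have "cmod z \<le> \<bar>Re z\<bar> + \<bar>Im z\<bar>" by (rule cmod_le)
          then have "1 + cmod z \<le> (1 + t) + (\<rho> + 3)" using z t by linarith
          also have "\<dots> \<le> (1 + t) * (1 + (\<rho> + 3))" using t rho_pos by (simp add: algebra_simps)
          also have "\<dots> \<le> (1 + t) * exp (\<rho> + 3)" using t by (intro mult_left_mono exp_ge_add_one_self) auto
          finally have "(1 + cmod z) ^ N \<le> ((1 + t) * exp (\<rho> + 3)) ^ N" by (intro power_mono) auto
          then have "(1 + cmod z) ^ N * M d \<le> ((1 + t) * exp (\<rho> + 3)) ^ N * M d"
            using M_pos[OF d] by (intro mult_right_mono) auto
          with out[OF d_eq(2)] have "cmod (H z) \<le> ((1 + t) * exp (\<rho> + 3)) ^ N * M d"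
            unfolding d_eq by linarith
          also have "\<dots> = exp (real N * ln (1 + t) + real N * (\<rho> + 3) + ln (M d))"
            using M_pos[OF d] t by (simp add: exp_add power_mult_distrib exp_of_nat_mult)
          also have "\<dots> \<le> exp (A * m d)"
          proof -
            have "ln (M d) \<le> ln (M (c * d))" using d Cc by (intro ln_M_decr) auto
            also have "\<dots> \<le> A * ln (M (c * d))"
              using A1 ln_M_gt_one[of "c * d"] Cc d by simp
            finally have 1: "ln (M d) \<le> A * ln (M (c * d))" .
            have "real N * (\<rho> + 3) \<le> A * (real N * (\<rho> + 3))"
              using A1 rho_pos mult_right_mono[OF A1, of "real N * (\<rho> + 3)"] by simp
            then have "real N * ln (1 + t) + real N * (\<rho> + 3) \<le> A * C1"
              using AN by (simp add: C1_def algebra_simps)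
            also have "C1 \<le> C / d"
            proof -
              have "C1 * d \<le> C1 * 2" using d2 C1 by (intro mult_left_mono) auto
              then show ?thesis using d C0 by (simp add: C_def pos_le_divide_eq)
            qed
            finally have "real N * ln (1 + t) + real N * (\<rho> + 3) \<le> A * (C / d)"
              using A1 by (simp add: mult_left_mono)
            then show ?thesis using 1 by (simp add: m_def distrib_left)
          qed
          finally show ?thesis by (simp add: d_def)
        qed
      qed (use A1 in auto)
    qed
  qed
qed


section \<open>Growth in the widened strip\<close>

text \<open>The critical exponent for half-width \<open>\<rho> + 1\<close>: in that strip
  \<open>exp (wide * z)\<close> has nonnegative real part, so \<open>kap\<close> has no pole
  there.\<close>

definition wide :: real where "wide = pi / (2 * (\<rho> + 1))"

lemma wide_pos: "wide > 0" and wide_rho: "wide * (\<rho> + 1) = pi / 2"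
  using rho_pos by (auto simp: wide_def field_simps)

text \<open>A holomorphic step: \<open>|kap| \<le> 1\<close>, while \<open>Im kap\<close> has the sign of \<open>Im z\<close> and is bounded away from 0
  near \<open>[0, 1] + \<i> \<rho>\<close>.\<close>

definition kap :: "complex \<Rightarrow> complex" where
  "kap z = - 1 / (exp (of_real wide * z) + 1)"

lemma kap_cnj: "kap (cnj z) = cnj (kap z)"
  by (simp add: kap_def exp_cnj)

lemma Re_exp_kap_nonneg:
  assumes "\<bar>Im z\<bar> \<le> \<rho> + 1"
  shows "Re (exp (of_real wide * z)) \<ge> 0"
proof -
  have "\<bar>wide * Im z\<bar> \<le> pi / 2"
    using mult_left_mono[OF assms, of wide] wide_pos unfolding wide_rho by (simp add: abs_mult)
  then have "cos (wide * Im z) \<ge> 0"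
    by (intro cos_ge_zero) (auto simp: abs_le_iff)
  then show ?thesis by (simp add: Re_exp)
qed

lemma kap_denominator:
  assumes "\<bar>Im z\<bar> \<le> \<rho> + 1"
  shows "cmod (exp (of_real wide * z) + 1) \<ge> 1"
  using Re_exp_kap_nonneg[OF assms] complex_Re_le_cmod[of "exp (of_real wide * z) + 1"]
  by simp

lemma kap_holomorphic: "kap holomorphic_on {z. \<bar>Im z\<bar> \<le> \<rho> + 1}"
  unfolding kap_def
proof (intro holomorphic_intros)
  fix z assume "z \<in> {z. \<bar>Im z\<bar> \<le> \<rho> + 1}"
  then show "exp (of_real wide * z) + 1 \<noteq> 0"
    using kap_denominator[of z] by auto
qed

lemma norm_kap_le: "\<bar>Im z\<bar> \<le> \<rho> + 1 \<Longrightarrow> cmod (kap z) \<le> 1"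
  using kap_denominator[of z] by (simp add: kap_def norm_divide divide_le_eq_1)

lemma Re_kap_nonpos:
  assumes "\<bar>Im z\<bar> \<le> \<rho> + 1"
  shows "Re (kap z) \<le> 0"
  using Re_exp_kap_nonneg[OF assms]
  by (simp add: kap_def Re_divide divide_nonneg_nonneg)

lemma Im_kap:
  "Im (kap z) = exp (wide * Re z) * sin (wide * Im z)
     / (cmod (exp (of_real wide * z) + 1))\<^sup>2"
  unfolding kap_def Im_divide cmod_power2 by (simp add: Im_exp)

lemma Im_kap_nonneg:
  assumes "0 \<le> Im z" "Im z \<le> \<rho> + 1"
  shows "Im (kap z) \<ge> 0"
proof -
  have "wide * Im z \<le> wide * (\<rho> + 1)"
    using assms wide_pos by (intro mult_left_mono) auto
  also have "\<dots> = pi / 2" by (rule wide_rho)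
  finally have "wide * Im z \<le> pi" using pi_gt_zero by linarith
  then have "sin (wide * Im z) \<ge> 0"
    using assms wide_pos by (intro sin_ge_zero) auto
  then show ?thesis unfolding Im_kap by simp
qed

definition kap_low :: real where
  "kap_low = sin (wide * \<rho>) / (exp wide + 1)\<^sup>2"

lemma kap_low_pos: "kap_low > 0"
proof -
  have "wide * \<rho> < pi" using wide_rho wide_pos pi_gt_zero unfolding distrib_left by linarith
  then have "sin (wide * \<rho>) > 0"
    using rho_pos wide_pos by (intro sin_gt_zero) auto
  moreover have "exp wide + 1 > 0" by (simp add: add_pos_pos)
  ultimately show ?thesis by (simp add: kap_low_def)
qed

text \<open>In \<open>Im_kap\<close> the numerator is least at \<open>Re z = 0\<close>,
  \<open>Im z = \<rho>\<close>, and the denominator is at most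
  \<open>(exp wide + 1)^2\<close>.\<close>

lemma Im_kap_ge:
  assumes "\<rho> \<le> Im z" "Im z \<le> \<rho> + 1" "0 \<le> Re z" "Re z \<le> 1"
  shows "Im (kap z) \<ge> kap_low"
proof -
  define g where "g = wide"
  have g: "g > 0" using wide_pos by (simp add: g_def)
  have "g * Im z \<le> g * (\<rho> + 1)" using assms g by (intro mult_left_mono) auto
  also have "\<dots> = pi / 2" by (simp add: g_def wide_rho)
  finally have gz: "g * Im z \<le> pi / 2" .
  have gr: "0 < g * \<rho>" "g * \<rho> \<le> g * Im z" using g rho_pos assms by auto
  have "sin (g * \<rho>) \<le> sin (g * Im z)"
    using gr gz pi_gt_zero by (intro sin_monotone_2pi_le) linarith+
  moreover have "1 \<le> exp (g * Re z)" using g assms by simp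
  moreover have "0 < sin (g * \<rho>)"
    using gr gz pi_gt_zero by (intro sin_gt_zero) linarith+
  ultimately have num: "sin (g * \<rho>) \<le> exp (g * Re z) * sin (g * Im z)" "0 < sin (g * \<rho>)"
    using mult_mono[of 1 "exp (g * Re z)" "sin (g * \<rho>)" "sin (g * Im z)"] by auto
  have "cmod (exp (of_real g * z)) \<le> exp g"
    using g assms by (simp add: norm_exp_eq_Re)
  then have den: "cmod (exp (of_real g * z) + 1) \<le> exp g + 1"
    using norm_triangle_ineq[of "exp (of_real g * z)" 1] unfolding norm_one by linarith
  have "cmod (exp (of_real g * z) + 1) \<ge> 1"
    using kap_denominator[of z] assms rho_pos by (simp add: g_def)
  then show ?thesis
    unfolding Im_kap kap_low_def g_def[symmetric] using num den
    by (intro frac_le power_mono zero_less_power) auto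
qed

text \<open>\<open>exp \<circ> G\<close> behaves like a conformal map onto the right half-plane of the domain obtained by
  widening the strip by \<open>e n\<close> over \<open>[n, n + 1]\<close>. As the \<open>e n\<close> are summable, \<open>Re G\<close> differs from
  its value \<open>crit * Re z\<close> for the strip by a bounded amount only.\<close>

lemma comparison_exponent:
  fixes e :: "nat \<Rightarrow> real"
  assumes e: "summable e" "\<And>n. e n \<ge> 0"
  obtains n0 where "\<And>k. \<exists>G. G holomorphic_on {z. \<bar>Im z\<bar> \<le> \<rho> + 1} \<and>
    (\<forall>z. \<bar>Im z\<bar> \<le> \<rho> + 1 \<longrightarrow> crit * Re z \<le> Re (G z) \<and> Re (G z) \<le> crit * Re z + pi / 2) \<and>
    (\<forall>z. \<bar>Im z\<bar> \<le> \<rho> \<longrightarrow> \<bar>Im (G z)\<bar> \<le> pi / 2) \<and>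
    (\<forall>z n. n0 \<le> n \<and> n < k \<and> real n \<le> Re z \<and> Re z \<le> real n + 1 \<and> \<bar>Im z\<bar> \<le> \<rho> + 1 \<and> \<bar>Im z\<bar> - \<rho> \<le> e n
        \<longrightarrow> \<bar>Im (G z)\<bar> \<le> pi / 2)"
proof -
  \<comment> \<open>With this factor the term of weight \<open>e n\<close> lowers
    \<open>Im G\<close> over \<open>[n, n + 1]\<close> by at least \<open>crit * e n\<close>, which
    is the most that the extra width adds.\<close>
  define K1 where "K1 = crit / kap_low"
  have K1: "K1 > 0" using crit_pos kap_low_pos by (simp add: K1_def)
  have "pi / 2 / K1 > 0" using K1 by simp
  \<comment> \<open>From \<open>n0\<close> on, the total correction stays below
    \<open>pi / 2\<close>, so in the upper half \<open>Im G\<close> cannot fall below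
    \<open>- pi / 2\<close>.\<close>
  then obtain n0 where n0: "\<And>n k. n \<ge> n0 \<Longrightarrow> \<bar>sum e {n..<k}\<bar> < pi / 2 / K1"
    using e(1) unfolding summable_Cauchy real_norm_def by metis
  show thesis
  proof (rule that[of n0])
    fix k :: nat
    define E where "E = sum e {n0..<k}"
    have E: "E \<ge> 0" "K1 * E \<le> pi / 2"
      using n0[of n0 k] e(2) K1 by (auto simp: E_def sum_nonneg field_simps)
    \<comment> \<open>Stopping at \<open>k\<close> keeps the sum finite; the bounds do not depend on
      \<open>k\<close>, which is later taken beyond the crosscut.\<close>
    define Ks where "Ks z = (\<Sum>n=n0..<k. of_real (e n) * kap (z - of_nat n))" for z
    define G where "G z = of_real crit * z - of_real K1 * Ks z" for z
    have hol: "G holomorphic_on {z. \<bar>Im z\<bar> \<le> \<rho> + 1}"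
    proof -
      have "(\<lambda>z. kap (z - of_nat n)) holomorphic_on {z. \<bar>Im z\<bar> \<le> \<rho> + 1}" for n
        by (rule holomorphic_on_compose_gen[OF _ kap_holomorphic, of "\<lambda>z. z - of_nat n", unfolded o_def])
           (auto intro!: holomorphic_intros)
      then show ?thesis unfolding G_def Ks_def by (intro holomorphic_intros) auto
    qed
    have ReG: "crit * Re z \<le> Re (G z) \<and> Re (G z) \<le> crit * Re z + pi / 2" if z: "\<bar>Im z\<bar> \<le> \<rho> + 1" for z
    proof -
      have k: "-1 \<le> Re (kap (z - of_nat n))" "Re (kap (z - of_nat n)) \<le> 0" for n
        using norm_kap_le[of "z - of_nat n"] Re_kap_nonpos[of "z - of_nat n"] z
          abs_Re_le_cmod[of "kap (z - of_nat n)"] by auto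
      have "Re (Ks z) \<le> 0"
        unfolding Ks_def using e(2) k by (auto intro!: sum_nonpos mult_nonneg_nonpos)
      then have "K1 * Re (Ks z) \<le> 0" using K1 by (simp add: mult_nonneg_nonpos)
      moreover have "- E \<le> Re (Ks z)"
        unfolding Ks_def E_def using e(2) mult_left_mono[OF k(1) e(2)]
        by (auto simp flip: sum_negf intro!: sum_mono)
      then have "K1 * - E \<le> K1 * Re (Ks z)" using K1 by (intro mult_left_mono) auto
      ultimately show ?thesis using E by (simp add: G_def)
    qed
    have upper: "\<bar>Im (G z)\<bar> \<le> pi / 2"
      if z: "0 \<le> Im z" "Im z \<le> \<rho> + 1" and
        alt: "Im z \<le> \<rho> \<or> (\<exists>n. n0 \<le> n \<and> n < k \<and> real n \<le> Re z \<and> Re z \<le> real n + 1 \<and> Im z - \<rho> \<le> e n)" for z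
    proof -
      have k: "Im (kap (z - of_nat n)) \<le> 1" "0 \<le> Im (kap (z - of_nat n))" for n
        using norm_kap_le[of "z - of_nat n"] Im_kap_nonneg[of "z - of_nat n"] z
          abs_Im_le_cmod[of "kap (z - of_nat n)"] by auto
      have Im_Ks: "Im (Ks z) = (\<Sum>n=n0..<k. e n * Im (kap (z - of_nat n)))"
        by (simp add: Ks_def)
      have "Im (Ks z) \<le> E"
        unfolding Im_Ks E_def using mult_left_mono[OF k(1) e(2)] by (auto intro!: sum_mono)
      then have "K1 * Im (Ks z) \<le> K1 * E" using K1 by (intro mult_left_mono) auto
      moreover have "crit * Im z \<ge> 0" using crit_pos z by simp
      ultimately have low: "Im (G z) \<ge> - (pi / 2)" using E by (simp add: G_def)
      have Ks0: "Im (Ks z) \<ge> 0" unfolding Im_Ks using e(2) k by (intro sum_nonneg) auto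
      have "Im (G z) \<le> pi / 2"
      proof (cases "Im z \<le> \<rho>")
        case True
        then have "crit * Im z \<le> crit * \<rho>" using crit_pos by simp
        moreover have "K1 * Im (Ks z) \<ge> 0" using K1 Ks0 by simp
        ultimately show ?thesis by (simp add: G_def crit_rho)
      next
        case False
        then obtain n where n: "n0 \<le> n" "n < k" "real n \<le> Re z" "Re z \<le> real n + 1" "Im z - \<rho> \<le> e n"
          using alt by blast
        have "e n * kap_low \<le> e n * Im (kap (z - of_nat n))"
          using n z False e(2) by (intro mult_left_mono Im_kap_ge) auto
        also have "\<dots> \<le> Im (Ks z)"
          unfolding Im_Ks using n e(2) k by (intro member_le_sum) auto
        finally have "K1 * (e n * kap_low) \<le> K1 * Im (Ks z)" using K1 by simp
        moreover have "K1 * (e n * kap_low) = crit * e n" using kap_low_pos by (simp add: K1_def)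
        moreover have "crit * Im z \<le> crit * (\<rho> + e n)" using n crit_pos by simp
        ultimately show ?thesis using crit_rho by (simp add: G_def distrib_left)
      qed
      with low show ?thesis by simp
    qed
    have cnj: "G (cnj z) = cnj (G z)" for z
      using kap_cnj[of "z - of_nat n" for n] by (simp add: G_def Ks_def)
    have both: "\<bar>Im (G z)\<bar> \<le> pi / 2"
      if z: "\<bar>Im z\<bar> \<le> \<rho> + 1" and
        alt: "\<bar>Im z\<bar> \<le> \<rho> \<or> (\<exists>n. n0 \<le> n \<and> n < k \<and> real n \<le> Re z \<and> Re z \<le> real n + 1 \<and> \<bar>Im z\<bar> - \<rho> \<le> e n)" for z
    proof (cases "Im z \<ge> 0")
      case True
      then show ?thesis using upper[of z] z alt by auto
    next
      case False
      then show ?thesis using upper[of "cnj z"] z alt by (auto simp: cnj)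
    qed
    show "\<exists>G. G holomorphic_on {z. \<bar>Im z\<bar> \<le> \<rho> + 1} \<and>
      (\<forall>z. \<bar>Im z\<bar> \<le> \<rho> + 1 \<longrightarrow> crit * Re z \<le> Re (G z) \<and> Re (G z) \<le> crit * Re z + pi / 2) \<and>
      (\<forall>z. \<bar>Im z\<bar> \<le> \<rho> \<longrightarrow> \<bar>Im (G z)\<bar> \<le> pi / 2) \<and>
      (\<forall>z n. n0 \<le> n \<and> n < k \<and> real n \<le> Re z \<and> Re z \<le> real n + 1 \<and> \<bar>Im z\<bar> \<le> \<rho> + 1 \<and> \<bar>Im z\<bar> - \<rho> \<le> e n
          \<longrightarrow> \<bar>Im (G z)\<bar> \<le> pi / 2)"
      using hol ReG both by (intro exI[of _ G] conjI allI impI) (auto intro!: both)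
  qed
qed

end

text \<open>A substitute for the harmonic measure of the arc in a half-disc: the real part of
  \<open>2 k W - W\<^sup>2\<close> is nonnegative, is at least 1 where \<open>|W| \<ge> 1\<close>, and is linear near the origin.\<close>

lemma Re_half_disc_majorant:
  assumes "Re W \<ge> 0" "cmod W \<le> k"
  shows "Re (2 * of_real k * W - W\<^sup>2) \<ge> (cmod W)\<^sup>2"
proof -
  have "Re W * (k - Re W) \<ge> 0"
    using assms complex_Re_le_cmod[of W] by (intro mult_nonneg_nonneg) auto
  then show ?thesis
    unfolding cmod_power2 by (simp add: power2_eq_square algebra_simps)
qed

section \<open>Phragmen--Lindelof in the widened strip\<close>

context strip_weight
begin

text \<open>The two alternatives are the kinds of boundary of the widened region: at distance 1 the
  weight is \<open>M 1\<close>, elsewhere it is at most \<open>exp (exp (b * Re z))\<close>. The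
  polynomial factor is absorbed since \<open>|z|\<close> is of order at most
  \<open>exp (b * Re z)\<close>.\<close>

lemma outer_growth:
  assumes b: "b > 0"
    and out: "\<And>z. \<bar>Im z\<bar> > \<rho> \<Longrightarrow> cmod (H z) \<le> (1 + cmod z) ^ N * M (\<bar>Im z\<bar> - \<rho>)"
    and z: "Re z \<ge> 0" "\<rho> < \<bar>Im z\<bar>" "\<bar>Im z\<bar> \<le> \<rho> + 1"
    and alt: "\<bar>Im z\<bar> = \<rho> + 1 \<or> ln (ln (M (\<bar>Im z\<bar> - \<rho>))) \<le> b * Re z"
  shows "cmod (H z) \<le> exp ((real N * (\<rho> + 1 + 1 / b) + ln (M 1)) * exp (b * Re z))"
proof -
  define E where "E = exp (b * Re z)"
  have E1: "E \<ge> 1" using b z by (simp add: E_def)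
  have Mp: "M (\<bar>Im z\<bar> - \<rho>) > 0" using z by (intro M_pos) auto
  have lnM: "ln (M (\<bar>Im z\<bar> - \<rho>)) \<le> ln (M 1) * E"
    using alt
  proof
    assume "\<bar>Im z\<bar> = \<rho> + 1"
    then show ?thesis using ln_M_gt_one[of 1] E1 by simp
  next
    assume "ln (ln (M (\<bar>Im z\<bar> - \<rho>))) \<le> b * Re z"
    moreover have L: "ln (M (\<bar>Im z\<bar> - \<rho>)) > 1" using z by (intro ln_M_gt_one) auto
    ultimately have "ln (M (\<bar>Im z\<bar> - \<rho>)) \<le> E"
      unfolding E_def by (metis exp_le_cancel_iff exp_ln less_trans zero_less_one)
    also have "\<dots> \<le> ln (M 1) * E" using ln_M_gt_one[of 1] E1 by simp
    finally show ?thesis .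
  qed
  have "b * Re z \<le> E" unfolding E_def using exp_ge_add_one_self[of "b * Re z"] by linarith
  then have "Re z \<le> E / b" using b by (simp add: field_simps)
  moreover have "\<rho> + 1 \<le> (\<rho> + 1) * E" using E1 rho_pos by simp
  ultimately have "cmod z \<le> (\<rho> + 1) * E + E / b"
    using cmod_le[of z] z by linarith
  also have "\<dots> = (\<rho> + 1 + 1 / b) * E" by (simp add: field_simps)
  finally have nz: "cmod z \<le> (\<rho> + 1 + 1 / b) * E" .
  have "(1 + cmod z) ^ N \<le> exp (cmod z) ^ N" by (intro power_mono exp_ge_add_one_self) auto
  also have "\<dots> = exp (real N * cmod z)" by (simp add: exp_of_nat_mult)
  also have "\<dots> \<le> exp (real N * ((\<rho> + 1 + 1 / b) * E))" using nz by (simp add: mult_left_mono)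
  finally have "(1 + cmod z) ^ N * M (\<bar>Im z\<bar> - \<rho>)
      \<le> exp (real N * ((\<rho> + 1 + 1 / b) * E)) * exp (ln (M 1) * E)"
    using Mp lnM by (intro mult_mono) (auto, metis exp_le_cancel_iff exp_ln)
  also have "\<dots> = exp ((real N * (\<rho> + 1 + 1 / b) + ln (M 1)) * E)"
    by (simp add: algebra_simps flip: exp_add)
  finally show ?thesis using out[OF z(2)] by (simp add: E_def)
qed

text \<open>The first alternative makes this a neighbourhood of the closed strip even if \<open>M\<close> is bounded near 0.\<close>

definition widened :: "real \<Rightarrow> complex set" where
  "widened b = {z. \<bar>Im z\<bar> - \<rho> < exp (- Re z) \<or> \<rho> < \<bar>Im z\<bar> \<and> ln (ln (M (\<bar>Im z\<bar> - \<rho>))) > b * Re z}"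

lemma strip_subset_widened: "\<bar>Im z\<bar> \<le> \<rho> \<Longrightarrow> z \<in> widened b"
  using exp_gt_zero[of "- Re z"] unfolding widened_def mem_Collect_eq by linarith

lemma open_widened: "open (widened b)"
proof -
  let ?U = "{z. \<rho> < \<bar>Im z\<bar>}"
  have "continuous_on ?U (\<lambda>z. M (\<bar>Im z\<bar> - \<rho>))"
    by (rule continuous_on_compose2[OF M_cont]) (auto intro!: continuous_intros)
  then have cont: "continuous_on ?U (\<lambda>z. ln (ln (M (\<bar>Im z\<bar> - \<rho>))))"
  proof (intro continuous_on_ln ballI)
    fix z :: complex assume "z \<in> ?U"
    then show "M (\<bar>Im z\<bar> - \<rho>) \<noteq> 0" "ln (M (\<bar>Im z\<bar> - \<rho>)) \<noteq> 0"
      using M_pos[of "\<bar>Im z\<bar> - \<rho>"] ln_M_gt_one[of "\<bar>Im z\<bar> - \<rho>"] by force+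
  qed
  have "continuous_on ?U (\<lambda>z. b * Re z)" by (intro continuous_intros)
  from open_Collect_less_Int[OF this cont] obtain A where A: "open A" "A \<inter> ?U = {z \<in> ?U. b * Re z < ln (ln (M (\<bar>Im z\<bar> - \<rho>)))}"
    by blast
  have U: "open ?U" by (intro open_Collect_less continuous_intros)
  have "open {z. \<bar>Im z\<bar> - \<rho> < exp (- Re z)}" by (intro open_Collect_less continuous_intros)
  then have "open ({z. \<bar>Im z\<bar> - \<rho> < exp (- Re z)} \<union> (A \<inter> ?U))"
    using A(1) U by blast
  also have "{z. \<bar>Im z\<bar> - \<rho> < exp (- Re z)} \<union> (A \<inter> ?U) = widened b"
    unfolding A(2) widened_def by blast
  finally show ?thesis .
qed

text \<open>Phragmen--Lindelof on the widened strip: its boundary lies so close to the strip that the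
  critical growth rate is unchanged, yet there \<open>ln M\<close> is only of order \<open>exp (b * Re z)\<close>.\<close>

lemma growth_right:
  assumes hol: "H holomorphic_on UNIV"
    and out: "\<And>z. \<bar>Im z\<bar> > \<rho> \<Longrightarrow> cmod (H z) \<le> (1 + cmod z) ^ N * M (\<bar>Im z\<bar> - \<rho>)"
    and b: "b > 0" "b * (\<rho> + 1) < pi / 2"
    and cross: "\<And>\<epsilon> T0. \<epsilon> > 0 \<Longrightarrow>
      \<exists>T\<ge>T0. \<forall>y. \<bar>y\<bar> \<le> \<rho> + 1 \<longrightarrow> cmod (H (Complex T y)) \<le> exp (\<epsilon> * exp (crit * T))"
  obtains C where "\<And>z. \<lbrakk>Re z \<ge> 0; \<bar>Im z\<bar> \<le> \<rho> + 1\<rbrakk> \<Longrightarrow> cmod (H z) \<le> exp (C * exp (b * Re z))"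
proof -
  obtain c :: "nat \<Rightarrow> real" where c: "summable c" "\<And>n. c n \<ge> 0"
    "\<And>n t. \<lbrakk>0 < t; t \<le> 1; ln (ln (M t)) > b * real n\<rbrakk> \<Longrightarrow> t \<le> c n"
    using ln_ln_M_inverse_summable[OF b(1) zero_less_one] by blast
  \<comment> \<open>\<open>c n\<close> covers the second alternative in \<open>widened\<close>, the
    geometric term the first.\<close>
  define e where "e n = c n + exp (-1) ^ n" for n :: nat
  have e: "summable e" "\<And>n. e n \<ge> 0"
    unfolding e_def using c by (auto intro!: summable_add summable_geometric)
  obtain n0 where G: "\<And>k. \<exists>G. G holomorphic_on {z. \<bar>Im z\<bar> \<le> \<rho> + 1} \<and>
    (\<forall>z. \<bar>Im z\<bar> \<le> \<rho> + 1 \<longrightarrow> crit * Re z \<le> Re (G z) \<and> Re (G z) \<le> crit * Re z + pi / 2) \<and>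
    (\<forall>z. \<bar>Im z\<bar> \<le> \<rho> \<longrightarrow> \<bar>Im (G z)\<bar> \<le> pi / 2) \<and>
    (\<forall>z n. n0 \<le> n \<and> n < k \<and> real n \<le> Re z \<and> Re z \<le> real n + 1 \<and> \<bar>Im z\<bar> \<le> \<rho> + 1 \<and> \<bar>Im z\<bar> - \<rho> \<le> e n
        \<longrightarrow> \<bar>Im (G z)\<bar> \<le> pi / 2)"
    by (rule comparison_exponent[OF e]) blast
  have width: "\<bar>Im z\<bar> - \<rho> \<le> e n"
    if "z \<in> widened b" "\<bar>Im z\<bar> \<le> \<rho> + 1" "real n \<le> Re z" for z n
    using that(1) unfolding widened_def mem_Collect_eq
  proof (elim disjE conjE)
    assume "\<bar>Im z\<bar> - \<rho> < exp (- Re z)"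
    also have "\<dots> \<le> exp (- real n)" using that by simp
    also have "\<dots> = exp (-1) ^ n" by (simp flip: exp_of_nat_mult)
    finally show ?thesis using c(2)[of n] by (simp add: e_def)
  next
    assume "\<rho> < \<bar>Im z\<bar>" "b * Re z < ln (ln (M (\<bar>Im z\<bar> - \<rho>)))"
    moreover have "b * real n \<le> b * Re z" using that b by simp
    ultimately have "\<bar>Im z\<bar> - \<rho> \<le> c n" using that by (intro c(3)) auto
    then show ?thesis unfolding e_def by (simp add: add_increasing2)
  qed
  define X where "X = cbox (Complex 0 (- \<rho> - 1)) (Complex (real n0) (\<rho> + 1))"
  have "compact (H ` X)"
    using hol by (intro compact_continuous_image continuous_on_subset[OF holomorphic_on_imp_continuous_on])
      (auto simp: X_def)
  then obtain B0 where B0: "\<And>z. z \<in> X \<Longrightarrow> cmod (H z) \<le> B0"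
    using compact_imp_bounded bounded_iff by (metis imageI)
  define C2 where "C2 = real N * (\<rho> + 1 + 1 / b) + ln (M 1)"
  define C3 where "C3 = \<bar>B0\<bar> + C2"
  have C2: "C2 \<ge> 0" using rho_pos b ln_M_gt_one[of 1] by (simp add: C2_def)
  have C3: "C3 \<ge> C2" "C3 \<ge> \<bar>B0\<bar>" "C3 \<ge> 0" using C2 by (auto simp: C3_def)
  \<comment> \<open>On the strip of half-width \<open>\<rho> + 1\<close> the real part of
    \<open>exp (b * z)\<close> is at least \<open>cb * exp (b * Re z)\<close>; hence the division by
    \<open>cb\<close> in \<open>C1\<close> below.\<close>
  define cb where "cb = cos (b * (\<rho> + 1))"
  have "b * (\<rho> + 1) > 0" using b rho_pos by simp
  then have cb: "cb > 0" "cb \<le> 1" unfolding cb_def using b(2) by (simp_all add: cos_gt_zero)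
  define C1 where "C1 = C3 / cb"
  have C1: "C1 \<ge> C3" "C1 \<ge> 0" using cb C3
    by (auto simp: C1_def pos_le_divide_eq mult_left_le)
  have left: "cmod (H z) \<le> exp (C3 * exp (b * Re z))"
    if "0 \<le> Re z" "Re z \<le> real n0" "\<bar>Im z\<bar> \<le> \<rho> + 1" for z
  proof -
    have "z \<in> X" using that by (auto simp: X_def in_cbox_complex_iff)
    then have "cmod (H z) \<le> \<bar>B0\<bar>" using B0[of z] by linarith
    also have "\<dots> \<le> C3 * 1" using C3 by simp
    also have "\<dots> \<le> C3 * exp (b * Re z)" using C3 that b by (intro mult_left_mono) auto
    also have "\<dots> \<le> exp (C3 * exp (b * Re z))" using exp_ge_add_one_self[of "C3 * exp (b * Re z)"] by linarith
    finally show ?thesis .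
  qed
  have outer: "cmod (H z) \<le> exp (C3 * exp (b * Re z))"
    if "0 \<le> Re z" "\<rho> < \<bar>Im z\<bar>" "\<bar>Im z\<bar> \<le> \<rho> + 1" "\<bar>Im z\<bar> = \<rho> + 1 \<or> z \<notin> widened b" for z
  proof -
    have "cmod (H z) \<le> exp (C2 * exp (b * Re z))"
      unfolding C2_def by (rule outer_growth[OF b(1) out]) (use that in \<open>auto simp: widened_def\<close>)
    also have "\<dots> \<le> exp (C3 * exp (b * Re z))" using C3 by (simp add: mult_right_mono)
    finally show ?thesis .
  qed
  define \<kappa> where "\<kappa> = exp (pi / 2)"
  have \<kappa>: "\<kappa> \<ge> 1" by (simp add: \<kappa>_def)
  have inner: "cmod (H \<zeta>) \<le> exp (C1 * exp (b * Re \<zeta>) + \<epsilon> * (3 * \<kappa>\<^sup>2 * exp (crit * Re \<zeta>)))"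
    if \<epsilon>: "\<epsilon> > 0" and \<zeta>: "Re \<zeta> > real n0" "\<bar>Im \<zeta>\<bar> < \<rho> + 1" "\<zeta> \<in> widened b" for \<zeta> \<epsilon>
  proof -
    obtain T where T: "T \<ge> Re \<zeta> + 1" and
      crossT: "\<And>y. \<bar>y\<bar> \<le> \<rho> + 1 \<Longrightarrow> cmod (H (Complex T y)) \<le> exp (\<epsilon> * exp (crit * T))"
      using cross[OF \<epsilon>] by blast
    obtain k :: nat where k: "T < real k" using reals_Archimedean2 by blast
    obtain G where holG: "G holomorphic_on {z. \<bar>Im z\<bar> \<le> \<rho> + 1}"
      and ReG: "\<And>z. \<bar>Im z\<bar> \<le> \<rho> + 1 \<Longrightarrow> crit * Re z \<le> Re (G z) \<and> Re (G z) \<le> crit * Re z + pi / 2"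
      and ImG: "\<And>z. \<bar>Im z\<bar> \<le> \<rho> \<Longrightarrow> \<bar>Im (G z)\<bar> \<le> pi / 2"
        "\<And>z n. \<lbrakk>n0 \<le> n; n < k; real n \<le> Re z; Re z \<le> real n + 1; \<bar>Im z\<bar> \<le> \<rho> + 1; \<bar>Im z\<bar> - \<rho> \<le> e n\<rbrakk>
          \<Longrightarrow> \<bar>Im (G z)\<bar> \<le> pi / 2"
      using G[of k] by blast
    define S where "S = {z. real n0 < Re z \<and> Re z < T \<and> \<bar>Im z\<bar> < \<rho> + 1} \<inter> widened b"
    define Y where "Y = cbox (Complex (real n0) (- \<rho> - 1)) (Complex T (\<rho> + 1))"
    have Y: "z \<in> Y \<longleftrightarrow> real n0 \<le> Re z \<and> Re z \<le> T \<and> \<bar>Im z\<bar> \<le> \<rho> + 1" for z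
      by (auto simp: Y_def in_cbox_complex_iff)
    have openS: "open S" unfolding S_def
      by (intro open_Int open_widened open_Collect_conj open_Collect_less continuous_intros)
    have SY: "S \<subseteq> Y" by (auto simp: S_def Y)
    have bddS: "bounded S" using SY bounded_cbox bounded_subset unfolding Y_def by blast
    have clS: "closure S \<subseteq> Y" using SY closed_cbox closure_minimal unfolding Y_def by blast
    have YI: "Y \<subseteq> {z. \<bar>Im z\<bar> \<le> \<rho> + 1}" by (auto simp: Y)
    \<comment> \<open>\<open>W\<close> sends the region left of the crosscut into the right half of
      the disc of radius \<kappa>, with \<open>|W| \<ge> 1\<close> on
      \<open>Re z = T\<close>.\<close>
    define W where "W z = exp (G z - of_real (crit * T))" for z
    have holW: "W holomorphic_on Y"
      unfolding W_def using holomorphic_on_subset[OF holG YI] by (intro holomorphic_intros)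
    have normW: "exp (crit * (Re z - T)) \<le> cmod (W z)" "cmod (W z) \<le> \<kappa> * exp (crit * (Re z - T))"
      if "z \<in> Y" for z
      using ReG[of z] that by (auto simp: Y W_def \<kappa>_def norm_exp_eq_Re algebra_simps simp flip: exp_add)
    have W_le: "cmod (W z) \<le> \<kappa>" if "z \<in> Y" for z
    proof -
      have "exp (crit * (Re z - T)) \<le> 1" using that crit_pos by (simp add: Y mult_nonneg_nonpos)
      then have "\<kappa> * exp (crit * (Re z - T)) \<le> \<kappa> * 1" using \<kappa> by (intro mult_left_mono) auto
      then show ?thesis using normW(2)[OF that] by simp
    qed
    have ReW_S: "Re (W z) \<ge> 0" if z: "z \<in> S" for z
    proof -
      have "\<bar>Im (G z)\<bar> \<le> pi / 2"
      proof (cases "\<bar>Im z\<bar> \<le> \<rho>")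
        case False
        define n where "n = nat \<lfloor>Re z\<rfloor>"
        have z': "real n0 < Re z" "Re z < T" "\<bar>Im z\<bar> < \<rho> + 1" "z \<in> widened b"
          using z by (simp_all add: S_def)
        have n: "real n \<le> Re z" "Re z \<le> real n + 1"
        proof -
          have "real n = of_int \<lfloor>Re z\<rfloor>" using z'(1) by (simp add: n_def)
          then show "real n \<le> Re z" "Re z \<le> real n + 1"
            using of_int_floor_le[of "Re z"] real_of_int_floor_add_one_ge[of "Re z"] by simp_all
        qed
        have "n0 \<le> n" using z'(1) by (simp add: n_def le_nat_floor)
        moreover have "n < k" using n(1) z'(2) k by linarith
        moreover have "\<bar>Im z\<bar> \<le> \<rho> + 1" using z'(3) by simp
        ultimately show ?thesis using ImG(2) n width[OF z'(4) _ n(1)] by blast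
      qed (rule ImG(1))
      then have "cos (Im (G z)) \<ge> 0" by (intro cos_ge_zero) (auto simp: abs_le_iff)
      then show ?thesis by (simp add: W_def Re_exp)
    qed
    have ReW: "Re (W z) \<ge> 0" if "z \<in> closure S" for z
    proof (rule continuous_ge_on_closure[OF _ that ReW_S])
      show "continuous_on (closure S) (\<lambda>z. Re (W z))"
        using clS holW by (intro continuous_intros continuous_on_subset[OF holomorphic_on_imp_continuous_on])
    qed
    define V where "V z = 2 * of_real \<kappa> * W z - (W z)\<^sup>2" for z
    have V: "Re (V z) \<ge> (cmod (W z))\<^sup>2" if "z \<in> closure S" for z
      unfolding V_def using that clS by (intro Re_half_disc_majorant ReW W_le) auto
    \<comment> \<open>\<open>H\<close> is damped by one harmonic majorant for each kind of boundary:
      \<open>C1 * Re (exp (b * z))\<close> for the left edge and the outer boundary, and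
      \<open>\<epsilon> * exp (crit * T) * Re V\<close> for the crosscut, where
      \<open>Re V \<ge> 1\<close>.\<close>
    define P where "P z = H z * exp (- (of_real C1 * exp (of_real b * z)) - of_real (\<epsilon> * exp (crit * T)) * V z)" for z
    have holP: "P holomorphic_on Y"
      unfolding P_def V_def using holW holomorphic_on_subset[OF hol]
      by (intro holomorphic_intros) auto
    have normP: "cmod (P z) = cmod (H z) / exp (C1 * exp (b * Re z) * cos (b * Im z) + \<epsilon> * exp (crit * T) * Re (V z))" for z
    proof -
      have "Re (- (of_real C1 * exp (of_real b * z)) - of_real (\<epsilon> * exp (crit * T)) * V z)
          = - (C1 * exp (b * Re z) * cos (b * Im z) + \<epsilon> * exp (crit * T) * Re (V z))"
        by (simp add: Re_exp)
      then show ?thesis unfolding P_def norm_mult norm_exp_eq_Re by (simp only: exp_minus divide_inverse)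
    qed
    have growth: "C3 * exp (b * Re z) \<le> C1 * exp (b * Re z) * cos (b * Im z)" if "z \<in> Y" for z
    proof -
      have "b * \<bar>Im z\<bar> \<le> b * (\<rho> + 1)" using that b by (simp add: Y)
      then have "cb \<le> cos (b * \<bar>Im z\<bar>)"
        unfolding cb_def
      proof (rule cos_monotone_0_pi_le[rotated])
        show "b * (\<rho> + 1) \<le> pi" using b(2) pi_gt_zero by linarith
      qed (use b(1) in auto)
      also have "cos (b * \<bar>Im z\<bar>) = cos (b * Im z)" by (cases "Im z \<ge> 0") auto
      finally have "C1 * exp (b * Re z) * cb \<le> C1 * exp (b * Re z) * cos (b * Im z)"
        using C1 by (intro mult_left_mono) auto
      then show ?thesis using cb by (simp add: C1_def)
    qed
    have "cmod (P \<zeta>) \<le> 1"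
    proof (rule maximum_modulus_frontier[where f = P and S = S and \<xi> = \<zeta>, OF _ _ bddS])
      show "P holomorphic_on interior S"
        using holP SY interior_subset by (meson holomorphic_on_subset order_trans)
      show "continuous_on (closure S) P"
        using holP clS holomorphic_on_imp_continuous_on continuous_on_subset by blast
      show "\<zeta> \<in> S" using \<zeta> T by (auto simp: S_def)
      fix z assume "z \<in> frontier S"
      then have z: "z \<in> closure S" "z \<notin> S" using openS by (auto simp: frontier_def interior_open)
      have zY: "z \<in> Y" using z clS by blast
      have V0: "\<epsilon> * exp (crit * T) * Re (V z) \<ge> 0"
        using V[OF z(1)] \<epsilon> order_trans[OF zero_le_power2] by (intro mult_nonneg_nonneg) auto
      have "cmod (H z) \<le> exp (C1 * exp (b * Re z) * cos (b * Im z) + \<epsilon> * exp (crit * T) * Re (V z))"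
      proof (cases "Re z = T")
        case True
        have "cmod (W z) \<ge> 1" using normW(1)[OF zY] True by simp
        then have "Re (V z) \<ge> 1" using V[OF z(1)] by (smt (verit) one_le_power)
        then have "\<epsilon> * exp (crit * T) * 1 \<le> \<epsilon> * exp (crit * T) * Re (V z)"
          using \<epsilon> by (intro mult_left_mono) auto
        moreover have "0 \<le> C1 * exp (b * Re z) * cos (b * Im z)"
          using growth[OF zY] C3 by (smt (verit) exp_gt_zero mult_nonneg_nonneg)
        moreover have "cmod (H z) \<le> exp (\<epsilon> * exp (crit * T))"
          using crossT[of "Im z"] zY True by (metis Y complex_surj)
        ultimately show ?thesis
          by (smt (verit) exp_le_cancel_iff)
      next
        case False
        have "cmod (H z) \<le> exp (C3 * exp (b * Re z))"
        proof (cases "Re z = real n0")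
          case True
          then show ?thesis using zY by (intro left) (auto simp: Y)
        next
          case nF: False
          then have "\<bar>Im z\<bar> = \<rho> + 1 \<or> z \<notin> widened b"
            using z(2) zY False by (auto simp: S_def Y)
          moreover have "\<rho> < \<bar>Im z\<bar>"
            using calculation strip_subset_widened[of z b] by force
          ultimately show ?thesis using zY by (intro outer) (auto simp: Y)
        qed
        then show ?thesis using growth[OF zY] V0 by (smt (verit) exp_le_cancel_iff)
      qed
      then show "cmod (P z) \<le> 1" by (simp add: normP)
    qed
    then have "cmod (H \<zeta>) \<le> exp (C1 * exp (b * Re \<zeta>) * cos (b * Im \<zeta>) + \<epsilon> * exp (crit * T) * Re (V \<zeta>))"
      by (simp add: normP)
    also have "\<dots> \<le> exp (C1 * exp (b * Re \<zeta>) + \<epsilon> * (3 * \<kappa>\<^sup>2 * exp (crit * Re \<zeta>)))"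
    proof -
      have \<zeta>Y: "\<zeta> \<in> Y" using \<zeta> T by (auto simp: Y)
      \<comment> \<open>\<open>V\<close> is at most linear in \<open>|W|\<close>, so the factor
        \<open>exp (crit * T)\<close> cancels and the bound is free of \<open>T\<close>.\<close>
      have "Re (V \<zeta>) \<le> cmod (V \<zeta>)" by (rule complex_Re_le_cmod)
      also have "\<dots> \<le> cmod (2 * of_real \<kappa> * W \<zeta>) + cmod ((W \<zeta>)\<^sup>2)"
        unfolding V_def by (rule norm_triangle_ineq4)
      also have "\<dots> = 2 * \<kappa> * cmod (W \<zeta>) + cmod (W \<zeta>) * cmod (W \<zeta>)"
        using \<kappa> by (simp add: norm_mult power2_eq_square)
      also have "\<dots> \<le> 2 * \<kappa> * cmod (W \<zeta>) + \<kappa> * cmod (W \<zeta>)"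
        using W_le[OF \<zeta>Y] by (simp add: mult_right_mono)
      also have "\<dots> = 3 * \<kappa> * cmod (W \<zeta>)" by simp
      also have "\<dots> \<le> 3 * \<kappa> * (\<kappa> * exp (crit * (Re \<zeta> - T)))"
        using normW(2)[OF \<zeta>Y] \<kappa> by (intro mult_left_mono) auto
      finally have "exp (crit * T) * Re (V \<zeta>) \<le> exp (crit * T) * (3 * \<kappa> * (\<kappa> * exp (crit * (Re \<zeta> - T))))"
        by simp
      also have "\<dots> = 3 * \<kappa>\<^sup>2 * exp (crit * Re \<zeta>)"
        by (simp add: power2_eq_square algebra_simps exp_diff)
      finally have "\<epsilon> * exp (crit * T) * Re (V \<zeta>) \<le> \<epsilon> * (3 * \<kappa>\<^sup>2 * exp (crit * Re \<zeta>))"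
        using \<epsilon> by (simp add: mult.assoc)
      moreover have "C1 * exp (b * Re \<zeta>) * cos (b * Im \<zeta>) \<le> C1 * exp (b * Re \<zeta>) * 1"
        using C1 by (intro mult_left_mono) auto
      ultimately show ?thesis by simp
    qed
    finally show ?thesis .
  qed
  have final: "cmod (H z) \<le> exp (C1 * exp (b * Re z))" if z: "Re z \<ge> 0" "\<bar>Im z\<bar> \<le> \<rho> + 1" for z
  proof -
    have C13: "exp (C3 * exp (b * Re z)) \<le> exp (C1 * exp (b * Re z))"
      using C1 by (simp add: mult_right_mono)
    consider "Re z \<le> real n0" | "Re z > real n0" "\<rho> < \<bar>Im z\<bar>" "\<bar>Im z\<bar> = \<rho> + 1 \<or> z \<notin> widened b"
      | "Re z > real n0" "\<bar>Im z\<bar> < \<rho> + 1" "z \<in> widened b"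
      using z strip_subset_widened[of z b] by fastforce
    then show ?thesis
    proof cases
      case 1
      then show ?thesis using order_trans[OF left C13] z by blast
    next
      case 2
      then show ?thesis using order_trans[OF outer C13] z by blast
    next
      case 3
      show ?thesis
      proof (cases "H z = 0")
        case False
        define Q where "Q = 3 * \<kappa>\<^sup>2 * exp (crit * Re z)"
        have Q: "Q > 0" using \<kappa> by (simp add: Q_def)
        have "ln (cmod (H z)) \<le> C1 * exp (b * Re z)"
        proof (rule field_le_epsilon)
          \<comment> \<open>With \<open>z\<close> fixed the crosscut term vanishes as \<epsilon>
            tends to 0; using \<open>\<epsilon> / Q\<close> makes the error exactly
            \<epsilon>.\<close>
          fix \<epsilon> :: real assume "\<epsilon> > 0"
          then have "cmod (H z) \<le> exp (C1 * exp (b * Re z) + \<epsilon> / Q * Q)"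
            unfolding Q_def using 3 \<kappa> by (intro inner) auto
          then show "ln (cmod (H z)) \<le> C1 * exp (b * Re z) + \<epsilon>"
            using False Q by (metis exp_le_cancel_iff exp_ln nonzero_eq_divide_eq order_less_irrefl zero_less_norm_iff)
        qed
        then show ?thesis using False by (metis exp_le_cancel_iff exp_ln zero_less_norm_iff)
      qed auto
    qed
  qed
  show thesis by (rule that[OF final])
qed

end

section \<open>Passage to the strip and conclusion\<close>

lemma frontier_strip:
  assumes "\<rho> > 0"
  shows "frontier (strip \<rho>) = {z. \<bar>Im z\<bar> = \<rho>}"
proof -
  have strip: "strip \<rho> = {z. Im z \<le> \<rho>} \<inter> {z. Im z \<ge> - \<rho>}"
    by (auto simp: strip_def)
  have int: "interior (strip \<rho>) = {z. Im z < \<rho>} \<inter> {z. Im z > - \<rho>}"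
    using interior_halfspace_le[of \<i> \<rho>] interior_halfspace_ge[of \<i> "- \<rho>"]
    unfolding strip interior_Int by (simp add: inner_complex_def)
  have "closed (strip \<rho>)"
    unfolding strip by (intro closed_Int closed_halfspace_Im_le closed_halfspace_Im_ge)
  then show ?thesis
    unfolding frontier_def int by (auto simp: strip_def)
qed

lemma infdist_frontier_strip:
  assumes "\<rho> > 0"
  shows "infdist z (frontier (strip \<rho>)) = \<bar>\<bar>Im z\<bar> - \<rho>\<bar>"
proof (rule antisym)
  define w where "w = Complex (Re z) (if Im z \<ge> 0 then \<rho> else - \<rho>)"
  have w: "w \<in> frontier (strip \<rho>)" using assms by (simp add: frontier_strip w_def)
  have "dist z w = cmod (z - w)" by (rule dist_norm)
  also have "\<dots> = \<bar>\<bar>Im z\<bar> - \<rho>\<bar>"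
    using assms by (auto simp: w_def cmod_def)
  finally show "infdist z (frontier (strip \<rho>)) \<le> \<bar>\<bar>Im z\<bar> - \<rho>\<bar>"
    using infdist_le[OF w, of z] by simp
  show "\<bar>\<bar>Im z\<bar> - \<rho>\<bar> \<le> infdist z (frontier (strip \<rho>))"
  proof (subst infdist_notempty)
    show "\<bar>\<bar>Im z\<bar> - \<rho>\<bar> \<le> (INF a\<in>frontier (strip \<rho>). dist z a)"
    proof (rule cINF_greatest)
      fix v assume v: "v \<in> frontier (strip \<rho>)"
      then have "\<bar>\<bar>Im z\<bar> - \<rho>\<bar> \<le> \<bar>Im (z - v)\<bar>" using assms by (auto simp: frontier_strip)
      also have "\<dots> \<le> dist z v" unfolding dist_norm by (rule abs_Im_le_cmod)
      finally show "\<bar>\<bar>Im z\<bar> - \<rho>\<bar> \<le> dist z v" .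
    qed (use w in auto)
  qed (use w in auto)
qed

lemma delta_minus_eq: "delta_minus \<rho> F = delta_plus \<rho> (\<lambda>z. F (- z))"
  by (simp add: delta_minus_def delta_plus_def)

text \<open>A limit superior above \<open>- \<epsilon>\<close> is witnessed arbitrarily far out, and
  the value \<open>- \<infinity>\<close> of \<open>log_abs\<close> at zeros excludes zeros of
  \<open>F\<close> as witnesses.\<close>

lemma delta_plus_less_imp_large:
  assumes "delta_plus \<rho> F < ereal \<epsilon>"
  obtains t where "t \<ge> T" "F (of_real t) \<noteq> 0"
    "- ln (cmod (F (of_real t))) < \<epsilon> * exp (pi / (2 * \<rho>) * t)"
proof -
  define g where "g t = ereal (exp (- (pi / (2 * \<rho>)) * t)) * log_abs (F (of_real t))" for t :: real
  have "\<exists>t\<ge>T. g t > ereal (- \<epsilon>)"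
  proof (rule ccontr)
    assume "\<not> ?thesis"
    then have "eventually (\<lambda>t. g t \<le> ereal (- \<epsilon>)) at_top"
      unfolding eventually_at_top_linorder by (metis linorder_not_less)
    then have "Limsup at_top g \<le> ereal (- \<epsilon>)" by (rule Limsup_bounded)
    then have "ereal \<epsilon> \<le> - Limsup at_top g"
      by (metis ereal_minus_le_minus ereal_uminus_uminus uminus_ereal.simps(1))
    then show False using assms unfolding delta_plus_def g_def by simp
  qed
  then obtain t where t: "t \<ge> T" "g t > ereal (- \<epsilon>)" by blast
  have nz: "F (of_real t) \<noteq> 0"
  proof
    assume "F (of_real t) = 0"
    then have "g t = - \<infinity>" by (simp add: g_def log_abs_def)
    then show False using t(2) by simp
  qed
  then have "exp (- (pi / (2 * \<rho>)) * t) * ln (cmod (F (of_real t))) > - \<epsilon>"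
    using t(2) by (simp add: g_def log_abs_def)
  then have "- ln (cmod (F (of_real t))) < \<epsilon> * exp (pi / (2 * \<rho>) * t)"
    by (simp add: exp_minus field_simps)
  then show thesis using that t nz by blast
qed

context strip_weight
begin

lemma crosscuts:
  assumes hol: "H holomorphic_on UNIV"
    and out: "\<And>z. \<bar>Im z\<bar> > \<rho> \<Longrightarrow> cmod (H z) \<le> (1 + cmod z) ^ N * M (\<bar>Im z\<bar> - \<rho>)"
    and inn: "\<And>\<epsilon>. \<epsilon> > 0 \<Longrightarrow> \<exists>F. F holomorphic_on open_strip \<rho> \<and> bounded (F ` open_strip \<rho>) \<and>
      delta_plus \<rho> F < ereal \<epsilon> \<and>
      (\<forall>z. \<bar>Im z\<bar> < \<rho> \<longrightarrow> cmod (F z * H z) \<le> (1 + cmod z) ^ N * M (\<rho> - \<bar>Im z\<bar>))"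
    and \<epsilon>: "\<epsilon> > 0"
  shows "\<exists>T\<ge>T0. \<forall>y. \<bar>y\<bar> \<le> \<rho> + 1 \<longrightarrow> cmod (H (Complex T y)) \<le> exp (\<epsilon> * exp (crit * T))"
proof (rule crosscut_bound[of N])
  fix K :: real
  assume K: "K > 0" and bound: "\<And>f H t A y. \<lbrakk>f holomorphic_on open_strip \<rho>; H holomorphic_on UNIV;
      \<And>z. \<bar>Im z\<bar> < \<rho> \<Longrightarrow> cmod (f z) \<le> 1;
      \<And>z. \<bar>Im z\<bar> < \<rho> \<Longrightarrow> cmod (f z * H z) \<le> (1 + cmod z) ^ N * M (\<rho> - \<bar>Im z\<bar>);
      \<And>z. \<bar>Im z\<bar> > \<rho> \<Longrightarrow> cmod (H z) \<le> (1 + cmod z) ^ N * M (\<bar>Im z\<bar> - \<rho>);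
      f (of_real t) \<noteq> 0; - ln (cmod (f (of_real t))) \<le> A; t \<ge> 0; A \<ge> 1; real N * ln (1 + t) \<le> A;
      \<bar>y\<bar> \<le> \<rho> + 1\<rbrakk>
      \<Longrightarrow> cmod (H (Complex t y)) \<le> exp (K * A)"
  \<comment> \<open>Half of \<open>A = 2 * \<delta> * exp (crit * t)\<close> pays for
    \<open>- ln |F t|\<close>, the other half for dividing \<open>F\<close> by its bound
    \<open>B\<close>; then \<open>K * A\<close> is exactly
    \<open>\<epsilon> * exp (crit * t)\<close>.\<close>
  define \<delta> where "\<delta> = \<epsilon> / (2 * K)"
  have \<delta>: "\<delta> > 0" using \<epsilon> K by (simp add: \<delta>_def)
  obtain F where F: "F holomorphic_on open_strip \<rho>" "bounded (F ` open_strip \<rho>)" "delta_plus \<rho> F < ereal \<delta>"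
    and FH: "\<And>z. \<bar>Im z\<bar> < \<rho> \<Longrightarrow> cmod (F z * H z) \<le> (1 + cmod z) ^ N * M (\<rho> - \<bar>Im z\<bar>)"
    using inn[OF \<delta>] by blast
  obtain B0 where B0: "\<And>z. \<bar>Im z\<bar> < \<rho> \<Longrightarrow> cmod (F z) \<le> B0"
    using F(2) unfolding bounded_iff open_strip_def by auto
  define B where "B = max 1 B0"
  have B: "B \<ge> 1" "\<And>z. \<bar>Im z\<bar> < \<rho> \<Longrightarrow> cmod (F z) \<le> B"
    using B0 by (auto simp: B_def intro: le_max_iff_disj[THEN iffD2])
  \<comment> \<open>Besides \<open>T0\<close> and 0, the thresholds ensure \<open>1 \<le> A\<close>,
    \<open>ln B \<le> \<delta> * exp (crit * t)\<close> and \<open>N * ln (1 + t) \<le> A\<close>,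
    the last through the quadratic lower bound for \<open>exp\<close>.\<close>
  define T1 where "T1 = max (max T0 0) (max (max (1 / (2 * \<delta> * crit)) (ln B / (\<delta> * crit))) (real N / (\<delta> * crit\<^sup>2)))"
  obtain t where t: "t \<ge> T1" "F (of_real t) \<noteq> 0" "- ln (cmod (F (of_real t))) < \<delta> * exp (crit * t)"
    using delta_plus_less_imp_large[OF F(3), of T1] unfolding crit_def by metis
  have tge: "t \<ge> T0" "t \<ge> 0" "1 / (2 * \<delta> * crit) \<le> t" "ln B / (\<delta> * crit) \<le> t" "real N / (\<delta> * crit\<^sup>2) \<le> t"
    using t(1) by (auto simp: T1_def)
  define A where "A = 2 * \<delta> * exp (crit * t)"
  have e1: "crit * t \<le> exp (crit * t)" using exp_ge_add_one_self[of "crit * t"] by linarith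
  have e2: "(crit * t)\<^sup>2 / 2 \<le> exp (crit * t)"
    using exp_lower_Taylor_quadratic[of "crit * t"] tge crit_pos by (smt (verit) mult_nonneg_nonneg)
  have A1: "A \<ge> 1"
  proof -
    have "1 \<le> 2 * \<delta> * (crit * t)" using tge(3) \<delta> crit_pos by (simp add: field_simps)
    also have "\<dots> \<le> A" unfolding A_def using e1 \<delta> by (intro mult_left_mono) auto
    finally show ?thesis .
  qed
  have AB: "ln B \<le> \<delta> * exp (crit * t)"
  proof -
    have "ln B \<le> \<delta> * (crit * t)" using tge(4) \<delta> crit_pos by (simp add: field_simps)
    also have "\<dots> \<le> \<delta> * exp (crit * t)" using e1 \<delta> by (intro mult_left_mono) auto
    finally show ?thesis .
  qed
  have AN: "real N * ln (1 + t) \<le> A"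
  proof -
    have "real N * ln (1 + t) \<le> real N * t"
      using tge(2) by (intro mult_left_mono ln_add_one_self_le_self) auto
    also have "real N \<le> t * (\<delta> * crit\<^sup>2)" using tge(5) \<delta> crit_pos by (simp add: pos_divide_le_eq)
    then have "real N * t \<le> t * (\<delta> * crit\<^sup>2) * t" using tge(2) by (intro mult_right_mono) auto
    also have "\<dots> = 2 * \<delta> * ((crit * t)\<^sup>2 / 2)" by (simp add: power2_eq_square)
    also have "\<dots> \<le> A" unfolding A_def using e2 \<delta> by (intro mult_left_mono) auto
    finally show ?thesis by simp
  qed
  have "cmod (H (Complex t y)) \<le> exp (K * A)" if y: "\<bar>y\<bar> \<le> \<rho> + 1" for y
  proof (rule bound[of "\<lambda>z. F z / of_real B", OF _ hol _ _ out _ _ tge(2) A1 AN y])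
    show "(\<lambda>z. F z / of_real B) holomorphic_on open_strip \<rho>"
      using B F(1) by (intro holomorphic_intros) auto
    show "cmod (F z / of_real B) \<le> 1" if "\<bar>Im z\<bar> < \<rho>" for z
      using B(1) B(2)[OF that] by (simp add: norm_divide)
    show "cmod (F z / of_real B * H z) \<le> (1 + cmod z) ^ N * M (\<rho> - \<bar>Im z\<bar>)" if "\<bar>Im z\<bar> < \<rho>" for z
    proof -
      have "cmod (F z / of_real B * H z) = cmod (F z * H z) / B"
        using B by (simp add: norm_divide norm_mult)
      also have "\<dots> \<le> cmod (F z * H z) / 1"
        using B by (intro divide_left_mono) auto
      finally show ?thesis using FH[OF that] by simp
    qed
    show "F (of_real t) / of_real B \<noteq> 0" using t B by simp
    show "- ln (cmod (F (of_real t) / of_real B)) \<le> A"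
      using t B AB by (simp add: norm_divide ln_div A_def)
  qed auto
  moreover have "K * A = \<epsilon> * exp (crit * t)" using K by (simp add: A_def \<delta>_def)
  ultimately show ?thesis using tge(1) by auto
qed

text \<open>The reflection \<open>z\<close> to \<open>- z\<close> exchanges
  \<open>delta_minus\<close> and \<open>delta_plus\<close> and preserves the other hypotheses, so
  the left half follows from the right.\<close>

lemma growth_both:
  assumes hol: "H holomorphic_on UNIV"
    and out: "\<And>z. \<bar>Im z\<bar> > \<rho> \<Longrightarrow> cmod (H z) \<le> (1 + cmod z) ^ N * M (\<bar>Im z\<bar> - \<rho>)"
    and b: "b > 0" "b * (\<rho> + 1) < pi / 2"
    and plus: "\<And>\<epsilon>. \<epsilon> > 0 \<Longrightarrow> \<exists>F. F holomorphic_on open_strip \<rho> \<and> bounded (F ` open_strip \<rho>) \<and>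
      delta_plus \<rho> F < ereal \<epsilon> \<and>
      (\<forall>z. \<bar>Im z\<bar> < \<rho> \<longrightarrow> cmod (F z * H z) \<le> (1 + cmod z) ^ N * M (\<rho> - \<bar>Im z\<bar>))"
    and minus: "\<And>\<epsilon>. \<epsilon> > 0 \<Longrightarrow> \<exists>F. F holomorphic_on open_strip \<rho> \<and> bounded (F ` open_strip \<rho>) \<and>
      delta_minus \<rho> F < ereal \<epsilon> \<and>
      (\<forall>z. \<bar>Im z\<bar> < \<rho> \<longrightarrow> cmod (F z * H z) \<le> (1 + cmod z) ^ N * M (\<rho> - \<bar>Im z\<bar>))"
  obtains C where "\<And>z. \<bar>Im z\<bar> \<le> \<rho> + 1 \<Longrightarrow> cmod (H z) \<le> exp (C * exp (b * \<bar>Re z\<bar>))"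
proof -
  obtain C1 where C1: "\<And>z. \<lbrakk>Re z \<ge> 0; \<bar>Im z\<bar> \<le> \<rho> + 1\<rbrakk> \<Longrightarrow> cmod (H z) \<le> exp (C1 * exp (b * Re z))"
    by (rule growth_right[OF hol out b crosscuts[OF hol out plus]]) blast+
  define J where "J z = H (- z)" for z
  have holJ: "J holomorphic_on UNIV"
    unfolding J_def by (rule holomorphic_on_compose_gen[OF _ hol, of uminus, unfolded o_def])
      (auto intro!: holomorphic_intros)
  have outJ: "\<And>z. \<bar>Im z\<bar> > \<rho> \<Longrightarrow> cmod (J z) \<le> (1 + cmod z) ^ N * M (\<bar>Im z\<bar> - \<rho>)"
    using out[of "- z" for z] by (simp add: J_def)
  have minusJ: "\<exists>F. F holomorphic_on open_strip \<rho> \<and> bounded (F ` open_strip \<rho>) \<and>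
      delta_plus \<rho> F < ereal \<epsilon> \<and>
      (\<forall>z. \<bar>Im z\<bar> < \<rho> \<longrightarrow> cmod (F z * J z) \<le> (1 + cmod z) ^ N * M (\<rho> - \<bar>Im z\<bar>))" if \<epsilon>: "\<epsilon> > 0" for \<epsilon>
  proof -
    obtain F where F: "F holomorphic_on open_strip \<rho>" "bounded (F ` open_strip \<rho>)" "delta_minus \<rho> F < ereal \<epsilon>"
      and FH: "\<And>z. \<bar>Im z\<bar> < \<rho> \<Longrightarrow> cmod (F z * H z) \<le> (1 + cmod z) ^ N * M (\<rho> - \<bar>Im z\<bar>)"
      using minus[OF \<epsilon>] by blast
    have sub: "uminus ` open_strip \<rho> \<subseteq> open_strip \<rho>" by (auto simp: open_strip_def)
    have "(\<lambda>z. F (- z)) holomorphic_on open_strip \<rho>"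
      by (rule holomorphic_on_compose_gen[OF _ F(1) sub, unfolded o_def]) (auto intro!: holomorphic_intros)
    moreover have "bounded ((\<lambda>z. F (- z)) ` open_strip \<rho>)"
      by (rule bounded_subset[OF F(2)]) (use sub in auto)
    moreover have "delta_plus \<rho> (\<lambda>z. F (- z)) < ereal \<epsilon>"
      using F(3) by (simp add: delta_minus_eq)
    moreover have "\<forall>z. \<bar>Im z\<bar> < \<rho> \<longrightarrow> cmod (F (- z) * J z) \<le> (1 + cmod z) ^ N * M (\<rho> - \<bar>Im z\<bar>)"
      using FH[of "- z" for z] by (simp add: J_def)
    ultimately show ?thesis by blast
  qed
  obtain C2 where C2: "\<And>z. \<lbrakk>Re z \<ge> 0; \<bar>Im z\<bar> \<le> \<rho> + 1\<rbrakk> \<Longrightarrow> cmod (J z) \<le> exp (C2 * exp (b * Re z))"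
    by (rule growth_right[OF holJ outJ b crosscuts[OF holJ outJ minusJ]]) blast+
  have "cmod (H z) \<le> exp (max C1 C2 * exp (b * \<bar>Re z\<bar>))" if z: "\<bar>Im z\<bar> \<le> \<rho> + 1" for z
  proof (cases "Re z \<ge> 0")
    case True
    have "cmod (H z) \<le> exp (C1 * exp (b * Re z))" using C1 True z by blast
    also have "\<dots> \<le> exp (max C1 C2 * exp (b * \<bar>Re z\<bar>))" using True by (simp add: mult_right_mono)
    finally show ?thesis .
  next
    case False
    have "cmod (H z) \<le> exp (C2 * exp (b * (- Re z)))" using C2[of "- z"] False z by (simp add: J_def)
    also have "\<dots> \<le> exp (max C1 C2 * exp (b * \<bar>Re z\<bar>))" using False by (simp add: mult_right_mono)
    finally show ?thesis .
  qed
  then show thesis by (rule that)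
qed

end

text \<open>The barrier is \<open>exp (- \<epsilon> E)\<close> with
  \<open>E = 2 cosh (b' z)\<close>: as \<open>b' * h < pi / 2\<close>, its exponent dominates the
  growth with \<open>b < b'\<close> in the whole closed strip. Then \<epsilon> tends to 0.\<close>

lemma Phragmen_Lindelof_strip:
  assumes hol: "g holomorphic_on {z. \<bar>Im z\<bar> \<le> h}" and h: "h > 0"
    and b: "0 < b" "b < b'" "b' * h < pi / 2"
    and growth: "\<And>z. \<bar>Im z\<bar> \<le> h \<Longrightarrow> cmod (g z) \<le> exp (C * exp (b * \<bar>Re z\<bar>))"
    and bdry: "\<And>z. \<bar>Im z\<bar> = h \<Longrightarrow> cmod (g z) \<le> B" and B: "B \<ge> 1" and \<zeta>: "\<bar>Im \<zeta>\<bar> \<le> h"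
  shows "cmod (g \<zeta>) \<le> B"
proof -
  define E where "E z = exp (of_real b' * z) + exp (- (of_real b' * z))" for z :: complex
  define c where "c = cos (b' * h)"
  have b': "b' > 0" using b by simp
  have bh: "0 < b' * h" using b' h by simp
  have c: "c > 0" unfolding c_def using bh b(3) by (rule cos_gt_zero)
  have ReE: "Re (E z) = (exp (b' * Re z) + exp (- (b' * Re z))) * cos (b' * Im z)" for z
    by (simp add: E_def Re_exp algebra_simps)
  have cos_ge: "cos (b' * Im z) \<ge> c" if "\<bar>Im z\<bar> \<le> h" for z
  proof -
    have "c \<le> cos (b' * \<bar>Im z\<bar>)"
      unfolding c_def
    proof (rule cos_monotone_0_pi_le[rotated])
      show "b' * h \<le> pi" using b(3) pi_gt_zero by linarith
    qed (use b' that in auto)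
    also have "\<dots> = cos (b' * Im z)" by (cases "Im z \<ge> 0") auto
    finally show ?thesis .
  qed
  have ReE_ge: "Re (E z) \<ge> c * exp (b' * \<bar>Re z\<bar>)" if "\<bar>Im z\<bar> \<le> h" for z
  proof -
    have "exp (b' * \<bar>Re z\<bar>) * c \<le> (exp (b' * Re z) + exp (- (b' * Re z))) * cos (b' * Im z)"
      using cos_ge[OF that] c by (intro mult_mono) (auto simp: abs_if)
    then show ?thesis by (simp add: ReE mult.commute)
  qed
  have eps: "cmod (g \<zeta>) \<le> B * exp (\<epsilon> * Re (E \<zeta>))" if \<epsilon>: "\<epsilon> > 0" for \<epsilon>
  proof -
    \<comment> \<open>Chosen so that \<open>C \<le> \<epsilon> * c * (b' - b) * R\<close>, which
      makes the barrier win on the vertical sides.\<close>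
    define R where "R = max (\<bar>Re \<zeta>\<bar>) (\<bar>C\<bar> / (\<epsilon> * c * (b' - b)))"
    have R: "\<bar>Re \<zeta>\<bar> \<le> R" "\<bar>C\<bar> / (\<epsilon> * c * (b' - b)) \<le> R" "R \<ge> 0"
      by (auto simp: R_def le_max_iff_disj)
    have CR: "C * exp (b * R) \<le> \<epsilon> * c * exp (b' * R)"
    proof -
      have "C \<le> \<epsilon> * c * ((b' - b) * R)"
        using R(2) \<epsilon> c b by (simp add: field_simps)
      also have "\<dots> \<le> \<epsilon> * c * exp ((b' - b) * R)"
        using \<epsilon> c order_trans[OF _ exp_ge_add_one_self[of "(b' - b) * R"]] by (intro mult_left_mono) auto
      finally have "C * exp (b * R) \<le> \<epsilon> * c * exp ((b' - b) * R) * exp (b * R)"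
        by (intro mult_right_mono) auto
      also have "\<dots> = \<epsilon> * c * exp (b' * R)" by (simp add: algebra_simps flip: exp_add)
      finally show ?thesis .
    qed
    define P where "P z = g z * exp (- of_real \<epsilon> * E z)" for z
    have normP: "cmod (P z) = cmod (g z) / exp (\<epsilon> * Re (E z))" for z
      unfolding P_def norm_mult norm_exp_eq_Re by (simp add: exp_minus[where 'a = real] divide_inverse)
    define Y where "Y = cbox (Complex (- R) (- h)) (Complex R h)"
    have Y: "z \<in> Y \<longleftrightarrow> \<bar>Re z\<bar> \<le> R \<and> \<bar>Im z\<bar> \<le> h" for z
      by (auto simp: Y_def in_cbox_complex_iff)
    have holP: "P holomorphic_on Y"
      unfolding P_def E_def
      by (intro holomorphic_intros holomorphic_on_subset[OF hol]) (auto simp: Y)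
    have "cmod (P \<zeta>) \<le> B"
    proof (rule maximum_modulus_frontier[where f = P and S = Y and \<xi> = \<zeta>])
      show "P holomorphic_on interior Y" using holP holomorphic_on_subset interior_subset by blast
      show "continuous_on (closure Y) P"
        using holP holomorphic_on_imp_continuous_on by (simp add: Y_def)
      show "bounded Y" by (simp add: Y_def)
      show "\<zeta> \<in> Y" using R \<zeta> by (simp add: Y)
      fix z assume "z \<in> frontier Y"
      moreover have "closed Y" unfolding Y_def by (rule closed_cbox)
      ultimately have zY: "z \<in> Y" "z \<notin> interior Y" by (auto simp: frontier_def)
      have "{z. \<bar>Re z\<bar> < R \<and> \<bar>Im z\<bar> < h} \<subseteq> interior Y"
      proof (rule interior_maximal)
        show "open {z. \<bar>Re z\<bar> < R \<and> \<bar>Im z\<bar> < h}"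
          by (intro open_Collect_conj open_Collect_less continuous_intros)
      qed (auto simp: Y)
      then have "\<not> (\<bar>Re z\<bar> < R \<and> \<bar>Im z\<bar> < h)" using zY(2) by blast
      then have z: "z \<in> Y" "\<bar>Re z\<bar> = R \<or> \<bar>Im z\<bar> = h" using zY(1) unfolding Y by linarith+
      have E0: "\<epsilon> * Re (E z) \<ge> \<epsilon> * c * exp (b' * \<bar>Re z\<bar>)"
        using ReE_ge[of z] z \<epsilon> by (simp add: Y mult.assoc)
      have E1: "\<epsilon> * c * exp (b' * \<bar>Re z\<bar>) \<ge> 0" using \<epsilon> c by simp
      from z(2) have "cmod (g z) \<le> B * exp (\<epsilon> * Re (E z))"
      proof
        assume "\<bar>Im z\<bar> = h"
        then have "cmod (g z) \<le> B * 1" using bdry by simp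
        also have "\<dots> \<le> B * exp (\<epsilon> * Re (E z))" using B E0 E1 by (intro mult_left_mono) auto
        finally show ?thesis .
      next
        assume zR: "\<bar>Re z\<bar> = R"
        have "cmod (g z) \<le> exp (C * exp (b * \<bar>Re z\<bar>))" using growth z by (simp add: Y)
        also have "\<dots> \<le> exp (\<epsilon> * Re (E z))" using CR E0 unfolding zR by simp
        also have "\<dots> \<le> B * exp (\<epsilon> * Re (E z))" using B by simp
        finally show ?thesis .
      qed
      then show "cmod (P z) \<le> B" by (simp add: normP divide_le_eq)
    qed
    then show ?thesis by (simp add: normP divide_le_eq)
  qed
  have "((\<lambda>\<epsilon>. B * exp (\<epsilon> * Re (E \<zeta>))) \<longlongrightarrow> B * exp (0 * Re (E \<zeta>))) (at_right 0)"
    by (intro tendsto_intros)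
  moreover have "eventually (\<lambda>\<epsilon>. cmod (g \<zeta>) \<le> B * exp (\<epsilon> * Re (E \<zeta>))) (at_right 0)"
    using eps by (auto simp: eventually_at_right_less intro!: eventually_mono[OF eventually_at_right_less])
  ultimately show ?thesis
    using tendsto_lowerbound by fastforce
qed

theorem theorem6p3:
  fixes \<rho> :: real and M :: "real \<Rightarrow> real" and \<Omega> :: "(complex \<Rightarrow> complex) set"
    and H :: "complex \<Rightarrow> complex" and N :: nat
  assumes rho_pos: "\<rho> > 0"
    and M_range: "\<forall>t>0. M t > exp 1"
    and M_C1: "\<exists>M'. (\<forall>t>0. (M has_real_derivative M' t) (at t)) \<and> continuous_on {0<..} M'"
    and M_decr: "\<forall>s t. 0 < s \<and> s \<le> t \<longrightarrow> M t \<le> M s"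
    and M_lim: "\<exists>L::real. ((\<lambda>t. t * ln (ln (M t))) \<longlongrightarrow> L) (at_right 0)"
    and M_int: "(\<lambda>t. ln (ln (M t))) integrable_on {0<..}"
    and Omega_hol: "\<forall>F\<in>\<Omega>. F holomorphic_on open_strip \<rho>"
    and Omega_bdd: "\<forall>F\<in>\<Omega>. bounded (F ` open_strip \<rho>)"
    and inf_plus: "(INF F\<in>\<Omega>. delta_plus \<rho> F) = 0"
    and inf_minus: "(INF F\<in>\<Omega>. delta_minus \<rho> F) = 0"
    and H_entire: "H holomorphic_on UNIV"
    and H_out: "\<forall>z. z \<notin> strip \<rho> \<longrightarrow>
                  cmod (H z) \<le> (1 + cmod z) ^ N * M (infdist z (frontier (strip \<rho>)))"
    and H_in: "\<forall>F\<in>\<Omega>. \<forall>z\<in>open_strip \<rho>.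
                  cmod (F z * H z) \<le> (1 + cmod z) ^ N * M (infdist z (frontier (strip \<rho>)))"
  shows "\<exists>p. \<forall>z. H z = poly p z"
proof -
  have "continuous_on {0<..} M"
    using M_C1 by (metis DERIV_isCont continuous_at_imp_continuous_on greaterThan_iff)
  then interpret strip_weight \<rho> M
    using rho_pos M_range M_decr M_int by unfold_locales auto
  have out: "cmod (H z) \<le> (1 + cmod z) ^ N * M (\<bar>Im z\<bar> - \<rho>)" if "\<bar>Im z\<bar> > \<rho>" for z
  proof -
    have "z \<notin> strip \<rho>" using that by (simp add: strip_def)
    then have "cmod (H z) \<le> (1 + cmod z) ^ N * M (infdist z (frontier (strip \<rho>)))"
      using H_out by blast
    then show ?thesis using that by (simp add: infdist_frontier_strip[OF rho_pos])
  qed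
  have inn: "cmod (F z * H z) \<le> (1 + cmod z) ^ N * M (\<rho> - \<bar>Im z\<bar>)" if "F \<in> \<Omega>" "\<bar>Im z\<bar> < \<rho>" for F z
  proof -
    have "z \<in> open_strip \<rho>" using that by (simp add: open_strip_def)
    then have "cmod (F z * H z) \<le> (1 + cmod z) ^ N * M (infdist z (frontier (strip \<rho>)))"
      using H_in that by blast
    then show ?thesis using that by (simp add: infdist_frontier_strip[OF rho_pos])
  qed
  have plus: "\<exists>F. F holomorphic_on open_strip \<rho> \<and> bounded (F ` open_strip \<rho>) \<and>
      delta_plus \<rho> F < ereal \<epsilon> \<and>
      (\<forall>z. \<bar>Im z\<bar> < \<rho> \<longrightarrow> cmod (F z * H z) \<le> (1 + cmod z) ^ N * M (\<rho> - \<bar>Im z\<bar>))" if "\<epsilon> > 0" for \<epsilon>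
  proof -
    have "(INF F\<in>\<Omega>. delta_plus \<rho> F) < ereal \<epsilon>" using that by (simp add: inf_plus)
    then obtain F where "F \<in> \<Omega>" "delta_plus \<rho> F < ereal \<epsilon>" by (auto simp: INF_less_iff)
    then show ?thesis using Omega_hol Omega_bdd inn by blast
  qed
  have minus: "\<exists>F. F holomorphic_on open_strip \<rho> \<and> bounded (F ` open_strip \<rho>) \<and>
      delta_minus \<rho> F < ereal \<epsilon> \<and>
      (\<forall>z. \<bar>Im z\<bar> < \<rho> \<longrightarrow> cmod (F z * H z) \<le> (1 + cmod z) ^ N * M (\<rho> - \<bar>Im z\<bar>))" if "\<epsilon> > 0" for \<epsilon>
  proof -
    have "(INF F\<in>\<Omega>. delta_minus \<rho> F) < ereal \<epsilon>" using that by (simp add: inf_minus)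
    then obtain F where "F \<in> \<Omega>" "delta_minus \<rho> F < ereal \<epsilon>" by (auto simp: INF_less_iff)
    then show ?thesis using Omega_hol Omega_bdd inn by blast
  qed
  \<comment> \<open>The critical exponents for half-widths \<open>\<rho> + 3\<close> and
    \<open>\<rho> + 2\<close>: both lie below that of half-width \<open>\<rho> + 1\<close>, with a
    gap between them for the barrier.\<close>
  define b where "b = pi / (2 * (\<rho> + 3))"
  define b' where "b' = pi / (2 * (\<rho> + 2))"
  have lt: "pi / (2 * s) * (\<rho> + 1) < pi / 2" if "s > \<rho> + 1" for s
  proof -
    have "pi * (\<rho> + 1) < pi * s" using that by (intro mult_strict_left_mono) auto
    then show ?thesis using that rho_pos by (simp add: field_simps)
  qed
  have b: "b > 0" "b < b'" "b * (\<rho> + 1) < pi / 2" "b' * (\<rho> + 1) < pi / 2"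
    using rho_pos lt[of "\<rho> + 3"] lt[of "\<rho> + 2"] unfolding b_def b'_def
    by (auto intro!: divide_strict_left_mono)
  obtain C where C: "\<And>z. \<bar>Im z\<bar> \<le> \<rho> + 1 \<Longrightarrow> cmod (H z) \<le> exp (C * exp (b * \<bar>Re z\<bar>))"
    using growth_both[OF H_entire out b(1,3) plus minus] by blast
  \<comment> \<open>The zero of \<open>q\<close> lies at distance 1 from the strip of half-width
    \<open>\<rho> + 1\<close>; dividing by \<open>q z ^ N\<close> removes the polynomial growth on
    its boundary lines.\<close>
  define q where "q z = z - \<i> * of_real (\<rho> + 2)" for z :: complex
  have q1: "cmod (q z) \<ge> 1" if "\<bar>Im z\<bar> \<le> \<rho> + 1" for z
    using abs_Im_le_cmod[of "q z"] that by (simp add: q_def)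
  have zq: "cmod z \<le> cmod (q z) + (\<rho> + 2)" and qz: "cmod (q z) \<le> cmod z + (\<rho> + 2)" for z
    using norm_triangle_ineq[of "q z" "\<i> * of_real (\<rho> + 2)"] norm_triangle_ineq4[of z "\<i> * of_real (\<rho> + 2)"] rho_pos
    by (simp_all add: q_def norm_mult del: of_real_add)
  define g where "g z = H z / q z ^ N" for z
  \<comment> \<open>On those lines the distance to the original strip is 1, hence
    \<open>M 1\<close>; the base comes from \<open>1 + |z| \<le> (\<rho> + 4) |q z|\<close>.\<close>
  define B where "B = (\<rho> + 4) ^ N * M 1"
  have M1: "M 1 \<ge> 1" using M_gt[of 1] exp_ge_add_one_self[of "1::real"] by linarith
  have B: "B \<ge> 1" unfolding B_def using mult_mono[of 1 "(\<rho> + 4) ^ N" 1 "M 1"] M1 rho_pos by simp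
  have strip_bound: "cmod (g z) \<le> B" if z: "\<bar>Im z\<bar> \<le> \<rho> + 1" for z
  proof (rule Phragmen_Lindelof_strip[OF _ _ b(1,2,4) _ _ B z])
    show "g holomorphic_on {z. \<bar>Im z\<bar> \<le> \<rho> + 1}"
      unfolding g_def q_def
    proof (intro holomorphic_intros holomorphic_on_subset[OF H_entire])
      fix z assume "z \<in> {z. \<bar>Im z\<bar> \<le> \<rho> + 1}"
      then show "(z - \<i> * of_real (\<rho> + 2)) ^ N \<noteq> 0" using q1[of z] by (auto simp: q_def)
    qed auto
    show "cmod (g z) \<le> exp (C * exp (b * \<bar>Re z\<bar>))" if "\<bar>Im z\<bar> \<le> \<rho> + 1" for z
    proof -
      have "cmod (g z) \<le> cmod (H z) / 1"
        unfolding g_def norm_divide norm_power using q1[OF that] by (intro divide_left_mono) (auto intro: less_le_trans[of 0 1])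
      then show ?thesis using C[OF that] by simp
    qed
    show "cmod (g z) \<le> B" if "\<bar>Im z\<bar> = \<rho> + 1" for z
    proof -
      have "1 + cmod z \<le> (\<rho> + 4) * cmod (q z)"
      proof -
        have "(\<rho> + 3) * 1 \<le> (\<rho> + 3) * cmod (q z)" using q1[of z] that rho_pos by (intro mult_left_mono) auto
        then show ?thesis using zq[of z] by (simp add: algebra_simps)
      qed
      then have "(1 + cmod z) ^ N \<le> ((\<rho> + 4) * cmod (q z)) ^ N" by (intro power_mono) auto
      then have "(1 + cmod z) ^ N * M 1 \<le> ((\<rho> + 4) * cmod (q z)) ^ N * M 1"
        using M1 by (intro mult_right_mono) auto
      then have "cmod (H z) \<le> B * cmod (q z) ^ N"
        using out[of z] that by (simp add: B_def power_mult_distrib mult_ac)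
      moreover have "cmod (q z) ^ N > 0" using q1[of z] that by (intro zero_less_power) auto
      ultimately show ?thesis by (simp add: g_def norm_divide norm_power divide_le_eq)
    qed
  qed (use rho_pos in auto)
  have poly_bound: "cmod (H z) \<le> (B * (\<rho> + 3) ^ N) * cmod z ^ N" if z: "1 \<le> cmod z" for z
  proof (cases "\<bar>Im z\<bar> \<le> \<rho> + 1")
    case True
    have "cmod (H z) = cmod (g z) * cmod (q z) ^ N"
      using q1[OF True] by (auto simp: g_def norm_divide norm_power)
    also have "\<dots> \<le> B * ((\<rho> + 3) * cmod z) ^ N"
    proof (intro mult_mono power_mono strip_bound True)
      have "(\<rho> + 2) * 1 \<le> (\<rho> + 2) * cmod z" using z rho_pos by (intro mult_left_mono) auto
      then show "cmod (q z) \<le> (\<rho> + 3) * cmod z" using qz[of z] by (simp add: algebra_simps)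
    qed (use B in auto)
    finally show ?thesis by (simp add: power_mult_distrib mult_ac)
  next
    case False
    have "M (\<bar>Im z\<bar> - \<rho>) \<le> M 1" using False by (intro strip_weight.M_decr[OF strip_weight_axioms]) auto
    moreover have "(1 + cmod z) ^ N \<le> (2 * cmod z) ^ N" using z by (intro power_mono) auto
    moreover have "M (\<bar>Im z\<bar> - \<rho>) \<ge> 0" using M_pos[of "\<bar>Im z\<bar> - \<rho>"] False by simp
    ultimately have "cmod (H z) \<le> (2 * cmod z) ^ N * M 1"
      using out[of z] False mult_mono[of "(1 + cmod z) ^ N" "(2 * cmod z) ^ N" "M (\<bar>Im z\<bar> - \<rho>)" "M 1"]
      by simp
    also have "\<dots> \<le> ((\<rho> + 3) * cmod z) ^ N * B"
    proof (intro mult_mono power_mono)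
      have "1 * M 1 \<le> B" unfolding B_def using M1 rho_pos by (intro mult_right_mono) auto
      then show "M 1 \<le> B" by simp
    qed (use rho_pos M1 in auto)
    finally show ?thesis by (simp add: power_mult_distrib mult_ac)
  qed
  \<comment> \<open>The Taylor polynomial of degree at most \<open>N\<close> at 0; by Liouville's
    theorem for polynomial growth it equals \<open>H\<close>.\<close>
  define p where "p = (\<Sum>k\<le>N. monom ((deriv ^^ k) H 0 / fact k) k)"
  have "H z = poly p z" for z
    using Liouville_polynomial[OF H_entire poly_bound, where \<xi> = z] by (simp add: p_def poly_sum poly_monom)
  then show ?thesis by blast
qed

end
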